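(* Let $K$ be a finite field with $q=|K|$ elements and $\mathrm{char}(K)>2$, and let $\mathcal L$ be a full spread for $\mathbb P^3_K$. If $G_{\mathcal L}$ is abelian, then $\mathcal L$ is projectively equivalent to the spread given by the fibers of the Hopf map $h\colon\mathbb P^3_K\to\mathbb P^1_J$. In particular, $G_{\mathcal L}$ is cyclic of order $q+1$.
   Context: A spread in $\mathbb P^3_K$ is a set of pairwise disjoint (skew) lines; it is full if every point of $\mathbb P^3_K$ lies on one of the lines. Let $K\subset J$ be the degree 2 field extension; choose $\alpha\in J$ with $J=K[\alpha]$ and $\alpha^2\in K$. The Hopf map is $h\colon\mathbb P^3_K\to\mathbb P^1_J$, $(a:b:c:d)\mapsto(a+\alpha b:c+\alpha d)$ (i.e. the canonical quotient $(J^2\setminus 0)/K^*\to(J^2\setminus0)/J^*$); its fibers are lines in $\mathbb P^3_K$ forming a full spread. Two sets of lines in $\mathbb P^3_K$ are projectively equivalent if an element of $PGL_4(K)$ takes one to the other. For a finite set $\mathcal L=\{L_1,\dots,L_s\}$ of $s\ge3$ skew lines in $\mathbb P^3_K$ and distinct $i,j,k$, let $f_{ijk}\colon L_i\to L_j$ be the linear isomorphism sending $p\in L_i$ to the point where the plane spanned by $p$ and $L_k$ meets $L_j$. The groupoid $C_{\mathcal L}$ has the lines $L_i$ as objects and all possible compositions of the maps $f_{ijk}$ as arrows. The groups $G_i=\mathrm{Hom}_{C_{\mathcal L}}(L_i,L_i)$ are all isomorphic, and $G_{\mathcal L}$ denotes any of them. *)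

theory Defs
  imports
    "HOL-Analysis.Analysis"
    "HOL-Computational_Algebra.Polynomial"
    "HOL-Algebra.Elementary_Groups"
begin

section \<open>Projective space over a field\<close>

text \<open>A point of the projective space of \<open>'a ^ 'n\<close> is a one-dimensional subspace of \<open>'a ^ 'n\<close>;
  flats (lines, planes, ...) are represented by their sets of points. All linear algebra is over
  \<open>'a\<close>, so the \<open>vec\<close> versions of the linear-algebra constants are used. Projective 3-space over
  \<open>'a\<close> is the case \<open>'n = 4\<close>, the projective line the case \<open>'n = 2\<close>.\<close>

definition proj_points :: "('a::field ^ 'n::finite) set set" where
  "proj_points = {P. vec.subspace P \<and> vec.dim P = 1}"

definition proj_flat :: "('a::field ^ 'n::finite) set \<Rightarrow> ('a ^ 'n) set set" where
  "proj_flat W = {P \<in> proj_points. P \<subseteq> W}"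

definition proj_lines :: "('a::field ^ 'n::finite) set set set" where
  "proj_lines = {proj_flat W |W. vec.subspace W \<and> vec.dim W = 2}"

definition proj_span :: "('a::field ^ 'n::finite) set set \<Rightarrow> ('a ^ 'n) set set" where
  "proj_span S = proj_flat (vec.span (\<Union>S))"

text \<open>An element of \<open>PGL\<^sub>4\<close> is represented by an invertible matrix; proportional
  matrices act in the same way on points.\<close>

definition proj_action ::
    "'a::field ^ 4 ^ 4 \<Rightarrow> ('a ^ 4) set \<Rightarrow> ('a ^ 4) set" where
  "proj_action A P = (*v) A ` P"

definition projectively_equivalent ::
    "('a::field ^ 4) set set set \<Rightarrow> ('a ^ 4) set set set \<Rightarrow> bool" where
  "projectively_equivalent \<L> \<M> \<longleftrightarrow>
     (\<exists>A :: 'a ^ 4 ^ 4. invertible A \<and> (\<lambda>L. proj_action A ` L) ` \<L> = \<M>)"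

section \<open>Spreads\<close>

definition spread :: "('a::field ^ 4) set set set \<Rightarrow> bool" where
  "spread \<L> \<longleftrightarrow> \<L> \<subseteq> proj_lines \<and> pairwise disjnt \<L>"

definition full_spread :: "('a::field ^ 4) set set set \<Rightarrow> bool" where
  "full_spread \<L> \<longleftrightarrow> spread \<L> \<and> (\<forall>P \<in> proj_points. \<exists>L \<in> \<L>. P \<in> L)"

section \<open>The groupoid of a set of skew lines\<close>

text \<open>The map from \<open>L\<close> to \<open>M\<close> sending \<open>p\<close> to the point in which the plane spanned by \<open>p\<close> and
  \<open>N\<close> meets \<open>M\<close>. That point is unique when the three lines are pairwise skew, the only case in
  which the map is used below. Arrows are made extensional (undefined off the source line), so
  that equality of functions is equality of arrows.\<close>

definition line_proj ::
    "('a::field ^ 4) set set \<Rightarrow> ('a ^ 4) set set \<Rightarrow> ('a ^ 4) set set \<Rightarrow>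
     ('a ^ 4) set \<Rightarrow> ('a ^ 4) set" where
  "line_proj L M N = (\<lambda>p \<in> L. THE x. x \<in> M \<inter> proj_span (insert p N))"

inductive arrow ::
    "('a::field ^ 4) set set set \<Rightarrow> ('a ^ 4) set set \<Rightarrow> ('a ^ 4) set set \<Rightarrow>
     (('a ^ 4) set \<Rightarrow> ('a ^ 4) set) \<Rightarrow> bool"
  for \<L> where
  arrow_id: "L \<in> \<L> \<Longrightarrow> arrow \<L> L L (\<lambda>p \<in> L. p)"
| arrow_proj: "\<lbrakk>L \<in> \<L>; M \<in> \<L>; N \<in> \<L>; L \<noteq> M; L \<noteq> N; M \<noteq> N\<rbrakk>
    \<Longrightarrow> arrow \<L> L M (line_proj L M N)"
| arrow_comp: "\<lbrakk>arrow \<L> L M f; arrow \<L> M N g\<rbrakk> \<Longrightarrow> arrow \<L> L N (compose L g f)"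

definition groupoid_group ::
    "('a::field ^ 4) set set set \<Rightarrow> ('a ^ 4) set set \<Rightarrow>
     (('a ^ 4) set \<Rightarrow> ('a ^ 4) set) monoid" where
  "groupoid_group \<L> L =
     \<lparr>carrier = {f. arrow \<L> L L f}, mult = compose L, one = (\<lambda>p \<in> L. p)\<rparr>"

section \<open>The Hopf map\<close>

definition field_embedding :: "('k::field \<Rightarrow> 'j::field) \<Rightarrow> bool" where
  "field_embedding \<iota> \<longleftrightarrow>
     \<iota> 1 = 1 \<and> (\<forall>x y. \<iota> (x + y) = \<iota> x + \<iota> y) \<and> (\<forall>x y. \<iota> (x * y) = \<iota> x * \<iota> y)"

text \<open>\<open>'j\<close> is an extension of degree 2 of \<open>'k\<close> along \<open>\<iota>\<close>, generated as a ring over \<open>'k\<close> by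
  \<open>\<alpha>\<close>, and \<open>\<alpha>\<^sup>2\<close> lies in \<open>'k\<close>.\<close>

definition quadratic_extension :: "('k::field \<Rightarrow> 'j::field) \<Rightarrow> 'j \<Rightarrow> bool" where
  "quadratic_extension \<iota> \<alpha> \<longleftrightarrow>
     field_embedding \<iota> \<and>
     vector_space.dim (\<lambda>c x. \<iota> c * x) (UNIV :: 'j set) = 2 \<and>
     (\<forall>x. \<exists>p :: 'k poly. x = poly (map_poly \<iota> p) \<alpha>) \<and>
     \<alpha>\<^sup>2 \<in> range \<iota>"

text \<open>On vectors the Hopf map is \<open>(a, b, c, d) \<mapsto> (a + \<alpha> b, c + \<alpha> d)\<close>. It maps the nonzero
  elements of a one-dimensional \<open>'k\<close>-subspace to nonzero elements of a single one-dimensional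
  \<open>'j\<close>-subspace, which is the span of the image.\<close>

definition hopf_vec :: "('k::field \<Rightarrow> 'j::field) \<Rightarrow> 'j \<Rightarrow> 'k ^ 4 \<Rightarrow> 'j ^ 2" where
  "hopf_vec \<iota> \<alpha> v = vector [\<iota> (v $ 1) + \<alpha> * \<iota> (v $ 2), \<iota> (v $ 3) + \<alpha> * \<iota> (v $ 4)]"

definition hopf_map :: "('k::field \<Rightarrow> 'j::field) \<Rightarrow> 'j \<Rightarrow> ('k ^ 4) set \<Rightarrow> ('j ^ 2) set" where
  "hopf_map \<iota> \<alpha> P = vec.span (hopf_vec \<iota> \<alpha> ` P)"

definition hopf_fibers :: "('k::field \<Rightarrow> 'j::field) \<Rightarrow> 'j \<Rightarrow> ('k ^ 4) set set set" where
  "hopf_fibers \<iota> \<alpha> = {{P \<in> proj_points. hopf_map \<iota> \<alpha> P = Q} |Q. Q \<in> proj_points}"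

end

theory Submission
  imports Defs "HOL-Algebra.Multiplicative_Group"
begin

text \<open>Fix three lines \<open>A\<close>, \<open>B\<close>, \<open>C\<close> of the spread as \<open>y = 0\<close>, \<open>x = 0\<close>, \<open>y = x\<close> in \<open>K\<^sup>2 \<times> K\<^sup>2\<close>. The
  other lines are graphs \<open>y = g x\<close> of linear maps, and the groupoid contains, as projective
  automorphisms of \<open>A\<close>, all differences \<open>g - h\<close> of two slopes with \<open>g \<noteq> 0\<close>. If the group is abelian,
  then \<open>g h = c h g\<close> and \<open>(g - 1) h = d h (g - 1)\<close> for scalars \<open>c\<close>, \<open>d\<close>, so \<open>(c - d) g = 1 - d\<close>; hence
  \<open>c = d = 1\<close> or \<open>g\<close> is scalar, and all slopes commute. Fullness of the spread provides a slope with
  prescribed value at a given vector, so the set of slopes is the centralizer \<open>K[a]\<close> of a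
  non-scalar slope \<open>a\<close>. After completing the square, \<open>a\<close> becomes \<open>T\<close> with \<open>T\<^sup>2 = m\<close> a nonsquare, and
  \<open>\<Theta> = T \<oplus> T\<close> preserves every line: the lines of the spread are the one-dimensional
  \<open>K[\<Theta>]\<close>-subspaces. Since nonsquares of a finite field differ by squares, this is the Hopf spread up to
  a change of basis. The arrows are exactly the \<open>K[\<Theta>]\<close>-linear maps, so the group is \<open>J\<^sup>*/K\<^sup>*\<close>.\<close>

section \<open>Points, lines and full spreads\<close>

lemma proj_points_iff: "P \<in> proj_points \<longleftrightarrow> (\<exists>v. v \<noteq> 0 \<and> P = vec.span {v})"
proof
  assume "P \<in> proj_points"
  then have P: "vec.subspace P" "vec.dim P = 1" by (auto simp: proj_points_def)
  obtain B where B: "B \<subseteq> P" "vec.independent B" "P \<subseteq> vec.span B" "card B = vec.dim P"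
    using vec.basis_exists by blast
  obtain v where v: "B = {v}" using B P by (auto simp: card_1_singleton_iff)
  have "v \<noteq> 0" using B v by auto
  moreover have "P = vec.span {v}"
    using B P v by (metis vec.span_subspace)
  ultimately show "\<exists>v. v \<noteq> 0 \<and> P = vec.span {v}" by blast
qed (auto simp: proj_points_def)

lemma span_singleton_subset_iff:
  "vec.subspace W \<Longrightarrow> vec.span {v} \<subseteq> W \<longleftrightarrow> v \<in> W"
  by (metis bot.extremum insert_subset vec.span_base vec.span_minimal singletonI subsetD)

lemma span_in_proj_flat_iff:
  assumes "vec.subspace W" "v \<noteq> 0"
  shows "vec.span {v} \<in> proj_flat W \<longleftrightarrow> v \<in> W"
  using assms span_singleton_subset_iff[OF assms(1), of v]
  by (auto simp: proj_flat_def proj_points_iff)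

lemma proj_flatE:
  assumes "p \<in> proj_flat W"
  obtains v where "v \<noteq> 0" "v \<in> W" "p = vec.span {v}"
  using assms by (auto simp: proj_flat_def proj_points_iff vec.span_base subset_iff)

text \<open>The zero vector lies on every point, so at least one point is required: for
  \<open>W = {0}\<close> the union would be empty.\<close>

lemma Union_proj_flat:
  fixes W :: "('a::field ^ 'b::finite) set"
  assumes "vec.subspace W" "vec.dim W \<noteq> 0"
  shows "\<Union>(proj_flat W) = W"
proof (rule Set.set_eqI)
  fix x
  obtain w where w: "w \<in> W" "w \<noteq> 0"
    using assms by (metis insert_subset vec.dim_eq_0 subsetI singletonI)
  show "x \<in> \<Union>(proj_flat W) \<longleftrightarrow> x \<in> W"
  proof
    assume "x \<in> W"
    moreover have "vec.span {w} \<in> proj_flat W" "(0::'a^'b) \<in> vec.span {w}"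
      using w assms by (auto simp: span_in_proj_flat_iff vec.span_zero)
    ultimately show "x \<in> \<Union>(proj_flat W)"
      using span_in_proj_flat_iff[OF assms(1), of x] vec.span_base[of x "{x}"]
      by (cases "x = 0") blast+
  qed (auto simp: proj_flat_def)
qed

text \<open>Recovers the two-dimensional subspace behind a line, so that incidence and skewness
  become statements about vectors.\<close>

definition affine_cone :: "('a::field ^ 'n::finite) set set \<Rightarrow> ('a ^ 'n) set" where
  "affine_cone L = \<Union>L"

lemma proj_linesD:
  assumes "L \<in> proj_lines"
  shows "vec.subspace (affine_cone L)" "vec.dim (affine_cone L) = 2" "L = proj_flat (affine_cone L)"
proof -
  obtain W where "vec.subspace W" "vec.dim W = 2" "L = proj_flat W"
    using assms by (auto simp: proj_lines_def)
  moreover from this have "affine_cone L = W" using Union_proj_flat[of W] by (simp add: affine_cone_def)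
  ultimately show "vec.subspace (affine_cone L)" "vec.dim (affine_cone L) = 2" "L = proj_flat (affine_cone L)" by simp_all
qed

lemma span_singleton_eq_iff:
  assumes "v \<noteq> 0"
  shows "vec.span {v} = vec.span {w} \<longleftrightarrow> (\<exists>c. c \<noteq> 0 \<and> v = c *s w)"
proof
  assume "vec.span {v} = vec.span {w}"
  then have "v \<in> vec.span {w}" by (metis vec.span_base singletonI)
  then show "\<exists>c. c \<noteq> 0 \<and> v = c *s w"
    using assms by (auto simp: vec.span_singleton) 
next
  assume "\<exists>c. c \<noteq> 0 \<and> v = c *s w"
  then obtain c where c: "c \<noteq> 0" "v = c *s w" by blast
  then have "w = inverse c *s v" by (simp add: vector_smult_assoc)
  then show "vec.span {v} = vec.span {w}"
    using c(2) by (metis subset_antisym span_singleton_subset_iff vec.span_base vec.subspace_span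
        vec.subspace_scale singletonI)
qed

lemma span_singleton_scale: "c \<noteq> 0 \<Longrightarrow> vec.span {c *s v} = vec.span {v}"
  using span_singleton_eq_iff[of "c *s v" v] by (cases "v = 0") auto

text \<open>By the dimension formula the sum of \<open>U\<close> and \<open>W\<close> has dimension
  2 + 2 - 0 = 4, so it is the whole space.\<close>

lemma subspace_dim2_decomp:
  fixes U W :: "('k::field ^ 4) set"
  assumes "vec.subspace U" "vec.dim U = 2" "vec.subspace W" "vec.dim W = 2" "U \<inter> W = {0}"
  shows "\<exists>a\<in>U. \<exists>b\<in>W. v = a + b"
proof -
  let ?S = "{x + y |x y. x \<in> U \<and> y \<in> W}"
  have "vec.dim ?S = 4"
    using vec.dim_sums_Int[OF assms(1,3)] assms by simp
  moreover have "vec.subspace ?S"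
    by (rule vec.subspace_sums[OF assms(1,3)])
  moreover have "vec.dim (UNIV :: ('k^4) set) = 4" by (simp only: vec_dim_card) simp
  ultimately have "?S = UNIV"
    by (intro vec.subspace_dim_equal) auto
  then show ?thesis by blast
qed

locale spread4 =
  fixes \<L> :: "('k::field ^ 4) set set set"
  assumes full: "full_spread \<L>"
begin

lemma line:
  assumes "L \<in> \<L>"
  shows "vec.subspace (affine_cone L)" "vec.dim (affine_cone L) = 2" "L = proj_flat (affine_cone L)"
proof -
  have "L \<in> proj_lines" using assms full by (auto simp: full_spread_def spread_def)
  then show "vec.subspace (affine_cone L)" "vec.dim (affine_cone L) = 2" "L = proj_flat (affine_cone L)"
    by (fact proj_linesD)+
qed

lemma span_in_line_iff: "L \<in> \<L> \<Longrightarrow> v \<noteq> 0 \<Longrightarrow> vec.span {v} \<in> L \<longleftrightarrow> v \<in> affine_cone L"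
  using line span_in_proj_flat_iff by metis

lemma lineE:
  assumes "L \<in> \<L>" "p \<in> L"
  obtains v where "v \<noteq> 0" "v \<in> affine_cone L" "p = vec.span {v}"
  using assms line(3) proj_flatE by metis

lemma zero_in_line: "L \<in> \<L> \<Longrightarrow> 0 \<in> affine_cone L"
  using line(1) vec.subspace_0 by blast

lemma meet:
  assumes "L \<in> \<L>" "M \<in> \<L>" "L \<noteq> M" "v \<in> affine_cone L" "v \<in> affine_cone M"
  shows "v = 0"
proof (rule ccontr)
  assume "v \<noteq> 0"
  then have "vec.span {v} \<in> L" "vec.span {v} \<in> M"
    using assms span_in_line_iff by blast+
  moreover have "disjnt L M"
    using full assms by (auto simp: full_spread_def spread_def pairwise_def)
  ultimately show False by (auto simp: disjnt_def)
qed

lemma cover: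
  obtains L where "L \<in> \<L>" "v \<in> affine_cone L"
proof -
  have nz: "\<exists>L\<in>\<L>. w \<in> affine_cone L" if "w \<noteq> 0" for w
  proof -
    have "vec.span {w} \<in> proj_points" using that proj_points_iff by blast
    then obtain L where "L \<in> \<L>" "vec.span {w} \<in> L"
      using full by (auto simp: full_spread_def)
    then show ?thesis using that span_in_line_iff by blast
  qed
  \<comment> \<open>The zero vector spans no point, but it lies in the cone of every line; any
    nonzero \<open>w\<close> supplies one.\<close>
  obtain w :: "'k^4" where "w \<noteq> 0" by (metis axis_eq_0_iff zero_neq_one)
  then show ?thesis using nz that zero_in_line by metis
qed

lemma nonzero_in_line:
  assumes "L \<in> \<L>"
  obtains v where "v \<in> affine_cone L" "v \<noteq> 0"
  using line(2)[OF assms]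
  by (metis insert_subset vec.dim_eq_0 subsetI singletonI zero_neq_numeral)

lemma decomp:
  assumes "L \<in> \<L>" "M \<in> \<L>" "L \<noteq> M"
  obtains a b where "a \<in> affine_cone L" "b \<in> affine_cone M" "v = a + b"
proof -
  have "affine_cone L \<inter> affine_cone M = {0}"
    using meet[OF assms] zero_in_line[OF assms(1)] zero_in_line[OF assms(2)]
    by blast
  then have "\<exists>a\<in>affine_cone L. \<exists>b\<in>affine_cone M. v = a + b"
    by (intro subspace_dim2_decomp line(1,2) assms)
  then show ?thesis using that by blast
qed

text \<open>With \<open>v = m + n\<close>, \<open>n\<close> in the cone of \<open>N\<close>, the
  vector \<open>m\<close> lies in the plane of \<open>v\<close> and \<open>N\<close>. Projections
  are thereby computed by decomposing vectors along \<open>M\<close> and \<open>N\<close>.\<close>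

lemma line_proj_span:
  assumes L: "L \<in> \<L>" and M: "M \<in> \<L>" and N: "N \<in> \<L>"
    and ne: "L \<noteq> M" "L \<noteq> N" "M \<noteq> N"
    and v: "v \<in> affine_cone L" "v \<noteq> 0" and m: "m \<in> affine_cone M" "v - m \<in> affine_cone N"
  shows "line_proj L M N (vec.span {v}) = vec.span {m}" "m \<noteq> 0"
proof -
  show m0: "m \<noteq> 0"
  proof
    assume "m = 0"
    then have "v \<in> affine_cone N" using m(2) by (simp only: diff_zero)
    then show False using meet[OF L N ne(2) v(1)] v(2) by blast
  qed
  have vL: "vec.span {v} \<in> L" using v L span_in_line_iff by blast
  let ?U = "vec.span (\<Union>(insert (vec.span {v}) N))"
  have "v \<in> ?U" "v - m \<in> ?U"
    using m(2)[unfolded affine_cone_def] vec.span_base[of v "{v}"] by (auto intro!: vec.span_base) 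
  then have "v - (v - m) \<in> ?U" by (rule vec.span_diff)
  then have mU: "m \<in> ?U" by simp
  have U: "\<exists>c. \<exists>n\<in>affine_cone N. x = c *s v + n" if "x \<in> ?U" for x
    using that
  proof (induction rule: vec.span_induct_alt)
    case base
    show ?case using zero_in_line[OF N] by (intro exI[of _ 0] bexI[of _ 0]) auto
  next
    case (step c x y)
    obtain d n where y: "n \<in> affine_cone N" "y = d *s v + n" using step by blast
    have "x \<in> affine_cone N \<or> x \<in> vec.span {v}"
      using step by (auto simp: affine_cone_def)
    then have "\<exists>d. \<exists>n\<in>affine_cone N. x = d *s v + n"
    proof (cases "x \<in> affine_cone N")
      case True
      then show ?thesis by (intro exI[of _ 0] bexI[of _ x]) auto
    next
      case False
      with \<open>_ \<or> _\<close> obtain d where "x = d *s v" by (auto simp: vec.span_singleton)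
      then show ?thesis using zero_in_line[OF N] by (metis add.right_neutral)
    qed
    then obtain d' n' where x: "n' \<in> affine_cone N" "x = d' *s v + n'" by blast
    have "c *s x + y = (c * d' + d) *s v + (c *s n' + n)"
      unfolding x(2) y(2) by (simp only: vec.scale_right_distrib vec.scale_left_distrib vec.scale_scale add_ac)
    moreover have "c *s n' + n \<in> affine_cone N"
      by (intro vec.subspace_add[OF line(1)[OF N]] vec.subspace_scale[OF line(1)[OF N]] x(1) y(1))
    ultimately show ?case by blast
  qed
  have "line_proj L M N (vec.span {v}) = (THE x. x \<in> M \<inter> proj_flat ?U)"
    using vL by (simp add: line_proj_def proj_span_def)
  also have "\<dots> = vec.span {m}"
  proof (rule the_equality)
    show "vec.span {m} \<in> M \<inter> proj_flat ?U"
      using m0 m(1) M mU span_in_line_iff span_in_proj_flat_iff[OF vec.subspace_span m0] by blast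
  next
    fix x assume x: "x \<in> M \<inter> proj_flat ?U"
    then obtain w where w: "w \<noteq> 0" "w \<in> affine_cone M" "x = vec.span {w}" using M lineE by blast
    have "w \<in> ?U" using x w(3) span_in_proj_flat_iff[OF vec.subspace_span w(1)] by blast
    then obtain c n where cn: "n \<in> affine_cone N" "w = c *s v + n" using U by blast
    \<comment> \<open>Uniqueness: this vector lies in the cones of both \<open>M\<close> and
      \<open>N\<close>, which are skew, so it vanishes and \<open>w\<close> is proportional to
      \<open>m\<close>.\<close>
    have "w - c *s m = c *s (v - m) + n" unfolding cn(2) by (simp add: vec.scale_right_diff_distrib)
    also have "\<dots> \<in> affine_cone N"
      by (intro vec.subspace_add[OF line(1)[OF N]] vec.subspace_scale[OF line(1)[OF N]] cn(1) m(2))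
    finally have "w - c *s m \<in> affine_cone N" .
    moreover have "w - c *s m \<in> affine_cone M"
      by (intro vec.subspace_diff[OF line(1)[OF M]] vec.subspace_scale[OF line(1)[OF M]] w(2) m(1))
    ultimately have "w - c *s m = 0" using meet[OF M N ne(3)] by blast
    then have "w = c *s m" by simp
    moreover have "c \<noteq> 0" using calculation w(1) by auto
    ultimately show "x = vec.span {m}" using w(3) by (simp add: span_singleton_scale)
  qed
  finally show "line_proj L M N (vec.span {v}) = vec.span {m}" .
qed

end

section \<open>Linear maps out of the plane \<open>K^2\<close>\<close>

abbreviation lin :: "('k::field ^ 'm::finite \<Rightarrow> 'k ^ 'n::finite) \<Rightarrow> bool" where
  "lin \<equiv> Vector_Spaces.linear (*s) (*s)"

lemma linI:
  assumes "\<And>x y. f (x + y) = f x + f y" "\<And>c x. f (c *s x) = c *s f x"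
  shows "lin f"
  by unfold_locales (auto simp: assms vec_eq_iff algebra_simps)

lemmas lin_simps = vec.linear_add vec.linear_scale vec.linear_diff vec.linear_neg vec.linear_0

lemma vec2_expand: "x = x$1 *s axis 1 1 + x$2 *s axis 2 1" for x :: "'k::field ^ 2"
  by (simp add: vec_eq_iff forall_2 axis_def)

lemma lin_axis:
  fixes x :: "'k::field ^ 2"
  assumes "lin f"
  shows "f x = x$1 *s f (axis 1 1) + x$2 *s f (axis 2 1)"
  using vec2_expand[of x] lin_simps[OF assms] by metis

text \<open>Arrows determine linear maps only up to a factor at each vector. Comparing the factors
  at two basis vectors and at their sum shows, by injectivity of \<open>g\<close>, that they
  agree.\<close>

lemma lin_pointwise_proportional:
  fixes f g :: "'k::field ^ 2 \<Rightarrow> 'k ^ 'n::finite"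
  assumes f: "lin f" and g: "lin g" and g0: "\<And>x. g x = 0 \<Longrightarrow> x = 0"
    and propor: "\<And>x. x \<noteq> 0 \<Longrightarrow> \<exists>c. f x = c *s g x"
  obtains c where "\<And>x. f x = c *s g x"
proof -
  let ?e = "axis 1 1 :: 'k^2" and ?d = "axis 2 1 :: 'k^2"
  have nz: "?e \<noteq> 0" "?d \<noteq> 0" "?e + ?d \<noteq> 0"
    by (auto simp: vec_eq_iff axis_def forall_2)
  obtain a b c where abc: "f ?e = a *s g ?e" "f ?d = b *s g ?d" "f (?e + ?d) = c *s g (?e + ?d)"
    using propor nz by meson
  have "g ((a - c) *s ?e + (b - c) *s ?d) = (a *s g ?e + b *s g ?d) - c *s (g ?e + g ?d)"
    unfolding lin_simps[OF g] by (simp add: vec_eq_iff algebra_simps)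
  also have "\<dots> = 0"
    using abc lin_simps[OF f] lin_simps[OF g] by (metis diff_self)
  finally have "(a - c) *s ?e + (b - c) *s ?d = 0" by (rule g0)
  then have "a = c" "b = c" by (auto simp: vec_eq_iff axis_def forall_2)
  then have "f x = c *s g x" for x
    unfolding lin_axis[OF f, of x] lin_axis[OF g, of x] abc(1,2)
    by (simp add: vec_eq_iff algebra_simps)
  then show ?thesis by (rule that)
qed

lemma subspace_dim2_parametrization:
  fixes U :: "('k::field ^ 'n::finite) set"
  assumes "vec.subspace U" "vec.dim U = 2"
  obtains E :: "'k ^ 2 \<Rightarrow> 'k ^ 'n" where "lin E" "\<And>x. E x = 0 \<Longrightarrow> x = 0" "range E = U"
proof -
  obtain B where B: "B \<subseteq> U" "vec.independent B" "U \<subseteq> vec.span B" "card B = 2"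
    using vec.basis_exists[of U] assms by metis
  obtain b d where bd: "B = {b, d}" "b \<noteq> d" using B(4) by (auto simp: card_2_iff)
  define E where "E x = x$1 *s b + x$2 *s d" for x :: "'k ^ 2"
  have lE: "lin E" by (rule linI) (auto simp: E_def vec_eq_iff algebra_simps)
  have inj: "x = 0" if "E x = 0" for x
  proof -
    have d0: "d \<noteq> 0" using B(2) bd vec.dependent_zero[of B] by auto
    have "x$1 = 0"
    proof (rule ccontr)
      assume n: "x$1 \<noteq> 0"
      have "x$1 *s b = - (x$2 *s d)" using that by (simp add: E_def eq_neg_iff_add_eq_0)
      then have "inverse (x$1) *s (x$1 *s b) = (- (x$2) / x$1) *s d"
        by (simp add: vec_eq_iff field_simps)
      then have "b = (- (x$2) / x$1) *s d" using n by (simp add: vec_eq_iff)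
      then have "b \<in> vec.span (B - {b})"
        using bd by (metis Diff_insert_absorb insertI1 insert_absorb insert_commute insert_not_empty
            singleton_insert_inj_eq' vec.span_base vec.span_scale Diff_iff singletonD)
      then show False using B(2) bd by (auto simp: vec.dependent_def)
    qed
    moreover have "x$2 = 0" using that calculation d0 by (simp add: E_def)
    ultimately show ?thesis by (simp add: vec_eq_iff forall_2)
  qed
  have "range E = U"
  proof
    show "range E \<subseteq> U"
      using assms(1) B(1) bd by (auto simp: E_def intro!: vec.subspace_add vec.subspace_scale)
    show "U \<subseteq> range E"
    proof
      fix u assume "u \<in> U"
      then have "u \<in> vec.span {b, d}" using B(3) bd by auto
      then obtain k l where "u = k *s b + l *s d"
        by (auto simp: vec.span_insert vec.span_singleton algebra_simps)
      then have "u = E (vector [k, l])" by (simp add: E_def)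
      then show "u \<in> range E" by blast
    qed
  qed
  then show ?thesis using that lE inj by blast
qed

section \<open>Projections and coordinates adapted to three lines of a spread\<close>

context spread4
begin

text \<open>\<open>P v\<close> is the component of \<open>v\<close> in \<open>L\<close>. It is
  unique because the cones meet only in 0, and uniqueness yields linearity.\<close>

lemma projection:
  assumes "L \<in> \<L>" "M \<in> \<L>" "L \<noteq> M"
  obtains P where "lin P" "\<And>v. P v \<in> affine_cone L" "\<And>v. v - P v \<in> affine_cone M"
proof -
  have "\<exists>a. a \<in> affine_cone L \<and> v - a \<in> affine_cone M" for v
    using decomp[OF assms, of v] by (metis add_diff_cancel_left')
  then obtain P where P: "\<And>v. P v \<in> affine_cone L" "\<And>v. v - P v \<in> affine_cone M" by metis
  have uniq: "P v = a" if "a \<in> affine_cone L" "v - a \<in> affine_cone M" for v a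
  proof -
    have "P v - a \<in> affine_cone L"
      using that P vec.subspace_diff line(1)[OF assms(1)] by blast
    moreover have "(v - a) - (v - P v) \<in> affine_cone M"
      using that P vec.subspace_diff line(1)[OF assms(2)] by blast
    ultimately show ?thesis using meet[OF assms, of "P v - a"] by simp
  qed
  have "lin P"
  proof (rule linI)
    fix x y c
    have "(x - P x) + (y - P y) \<in> affine_cone M" using P by (intro vec.subspace_add line(1) assms)
    then have "(x + y) - (P x + P y) \<in> affine_cone M" by (simp add: algebra_simps)
    then show "P (x + y) = P x + P y"
      using P by (intro uniq vec.subspace_add line(1) assms)
    have "c *s (x - P x) \<in> affine_cone M" using P by (intro vec.subspace_scale line(1) assms)
    then have "c *s x - c *s P x \<in> affine_cone M" by (simp add: vec.scale_right_diff_distrib)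
    then show "P (c *s x) = c *s P x"
      using P by (intro uniq vec.subspace_scale line(1) assms)
  qed
  then show ?thesis using that P by blast
qed

text \<open>For \<open>v\<close> outside \<open>L\<close> and \<open>a\<close> nonzero in
  \<open>L\<close>, the lines through \<open>v\<close> and \<open>a + v\<close> will do: any
  coincidence would put \<open>v\<close> into \<open>L\<close> or \<open>a\<close> into
  \<open>M\<close>.\<close>

lemma two_more_lines:
  assumes "L \<in> \<L>"
  obtains M N where "M \<in> \<L>" "N \<in> \<L>" "L \<noteq> M" "L \<noteq> N" "M \<noteq> N"
proof -
  have "affine_cone L \<noteq> UNIV" using line(2)[OF assms] vec_dim_card[where 'a='k and 'n=4] by auto
  then obtain v where v: "v \<notin> affine_cone L" by blast
  obtain M where M: "M \<in> \<L>" "v \<in> affine_cone M" using cover .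
  obtain a where a: "a \<in> affine_cone L" "a \<noteq> 0" using nonzero_in_line[OF assms] .
  obtain N where N: "N \<in> \<L>" "a + v \<in> affine_cone N" using cover .
  have LM: "L \<noteq> M" using M v by auto
  moreover have "L \<noteq> N"
  proof
    assume "L = N"
    then have "(a + v) - a \<in> affine_cone L" using a N line(1) by (metis vec.subspace_diff)
    then show False using v by simp
  qed
  moreover have "M \<noteq> N"
  proof
    assume "M = N"
    then have "(a + v) - v \<in> affine_cone M" using M N line(1) by (metis vec.subspace_diff)
    then show False using a meet[OF assms M(1) LM] by simp
  qed
  ultimately show ?thesis using that M N by blast
qed

end

text \<open>The map \<open>(x, y)\<close> to \<open>E x + F y\<close> identifies
  \<open>K^2 x K^2\<close> with \<open>K^4\<close>; \<open>diagonal\<close> makes \<open>C\<close>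
  the line \<open>y = x\<close>, which fixes \<open>F\<close> once \<open>E\<close> is
  chosen.\<close>

locale frame4 = spread4 \<L> for \<L> :: "('k::field ^ 4) set set set" +
  fixes A B C :: "('k ^ 4) set set" and E F :: "'k ^ 2 \<Rightarrow> 'k ^ 4"
  assumes lines: "A \<in> \<L>" "B \<in> \<L>" "C \<in> \<L>"
    and distinct: "A \<noteq> B" "A \<noteq> C" "B \<noteq> C"
    and linE: "lin E" and linF: "lin F"
    and injE: "E x = 0 \<Longrightarrow> x = 0" and injF: "F x = 0 \<Longrightarrow> x = 0"
    and ranE: "range E = affine_cone A" and ranF: "range F = affine_cone B"
    and diagonal: "E x + F x \<in> affine_cone C"

lemma (in spread4) frame_exists:
  assumes A: "A \<in> \<L>"
  obtains B C E F where "frame4 \<L> A B C E F"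
proof -
  obtain B C where BC: "B \<in> \<L>" "C \<in> \<L>" "A \<noteq> B" "A \<noteq> C" "B \<noteq> C"
    using two_more_lines[OF A] .
  obtain E :: "'k ^ 2 \<Rightarrow> 'k ^ 4" where E: "lin E" "\<And>x. E x = 0 \<Longrightarrow> x = 0" "range E = affine_cone A"
    using subspace_dim2_parametrization line(1,2)[OF A] by metis
  obtain P where P: "lin P" "\<And>v. P v \<in> affine_cone B" "\<And>v. v - P v \<in> affine_cone C"
    using projection[OF BC(1,2,5)] by blast
  \<comment> \<open>The sign puts \<open>E x + F x = E x - P (E x)\<close> into the cone of
    \<open>C\<close>.\<close>
  define F where "F x = - P (E x)" for x
  have EA: "E x \<in> affine_cone A" for x using E by auto
  have FB: "F x \<in> affine_cone B" for x using P line(1)[OF BC(1)] by (simp add: F_def vec.subspace_neg)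
  have EF: "E x + F x \<in> affine_cone C" for x using P(3)[of "E x"] by (simp add: F_def)
  have lF: "lin F" unfolding F_def
    by (rule linI) (simp_all add: lin_simps[OF E(1)] lin_simps[OF P(1)])
  have F0: "x = 0" if "F x = 0" for x
    using EF[of x] that meet[OF A BC(2) BC(4) EA] E(2) by simp
  have "affine_cone B \<subseteq> range F"
  proof
    fix y assume y: "y \<in> affine_cone B"
    obtain a c where ac: "a \<in> affine_cone A" "c \<in> affine_cone C" "y = a + c"
      using decomp[OF A BC(2) BC(4)] .
    then obtain x where x: "E (- x) = a" using E by (metis imageE minus_minus)
    \<comment> \<open>Since \<open>a = - E x\<close>, this vector equals \<open>y - F x\<close>,
      which lies in \<open>B\<close> as well; skewness of \<open>B\<close> and \<open>C\<close>
      gives \<open>y = F x\<close>.\<close>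
    have "c - (E x + F x) \<in> affine_cone C"
      using ac EF line(1)[OF BC(2)] by (metis vec.subspace_diff)
    moreover have "c - (E x + F x) = y - F x"
      using ac x[symmetric] lin_simps(4)[OF E(1), of x] by simp
    moreover have "y - F x \<in> affine_cone B"
      using y FB line(1)[OF BC(1)] by (metis vec.subspace_diff)
    ultimately have "y - F x = 0" using meet[OF BC(1,2,5)] by metis
    then show "y \<in> range F" by auto
  qed
  then have rF: "range F = affine_cone B" using FB by blast
  have "frame4 \<L> A B C E F"
    by (intro frame4.intro frame4_axioms.intro spread4_axioms) (fact A BC E lF F0 EF rF)+
  then show ?thesis using that by blast
qed

section \<open>Slopes of the lines of a spread\<close>

context frame4
begin

lemma E_in: "E x \<in> affine_cone A" and F_in: "F x \<in> affine_cone B"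
  using ranE ranF by auto

lemma coords_unique:
  assumes "E x + F y = E x' + F y'"
  shows "x = x'" "y = y'"
proof -
  have eq: "E (x - x') = F (y' - y)"
    using assms unfolding lin_simps[OF linE] lin_simps[OF linF] by (simp add: algebra_simps)
  then have "E (x - x') \<in> affine_cone B" by (simp add: F_in)
  then have "E (x - x') = 0" using meet[OF lines(1,2) distinct(1) E_in] by blast
  moreover from this eq have "F (y' - y) = 0" by simp
  ultimately show "x = x'" "y = y'" using injE injF by fastforce+
qed

lemma coords:
  obtains x y where "v = E x + F y"
  using decomp[OF lines(1,2) distinct(1), of v] ranE ranF by (metis imageE)

text \<open>The line \<open>W\<close> is the graph of \<open>g\<close>. The line \<open>B\<close>,
  being \<open>x = 0\<close>, is not a graph. Linearity of \<open>g\<close> is a consequence of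
  uniqueness, see \<open>slope_lin\<close>.\<close>

definition slope :: "('k ^ 4) set set \<Rightarrow> ('k ^ 2 \<Rightarrow> 'k ^ 2) \<Rightarrow> bool" where
  "slope W g \<longleftrightarrow> W \<in> \<L> \<and> W \<noteq> B \<and> (\<forall>x. E x + F (g x) \<in> affine_cone W)"

lemma slopeD:
  assumes "slope W g"
  shows "W \<in> \<L>" "W \<noteq> B" "E x + F (g x) \<in> affine_cone W"
  using assms by (auto simp: slope_def)

lemma slope_unique:
  assumes "slope W g" "E x + F y \<in> affine_cone W"
  shows "y = g x"
proof -
  have "(E x + F y) - (E x + F (g x)) \<in> affine_cone W"
    using assms slopeD line(1) vec.subspace_diff by metis
  then have "F (y - g x) \<in> affine_cone W" by (simp add: lin_simps[OF linF])
  then have "F (y - g x) = 0"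
    using meet[OF lines(2) slopeD(1)[OF assms(1)] _ F_in] slopeD(2)[OF assms(1)] by blast
  then show ?thesis using injF by fastforce
qed

lemma slope_exists:
  assumes "W \<in> \<L>" "W \<noteq> B"
  obtains g where "slope W g"
proof -
  have "\<exists>y. E x + F y \<in> affine_cone W" for x
  proof -
    obtain b w where bw: "b \<in> affine_cone B" "w \<in> affine_cone W" "E x = b + w"
      using decomp[OF lines(2) assms(1)] assms(2) by metis
    then obtain z where "b = F z" using ranF by (metis imageE)
    then have "E x + F (- z) = w" using bw by (simp add: lin_simps[OF linF])
    then show ?thesis using bw by metis
  qed
  then show ?thesis using that assms unfolding slope_def by metis
qed

lemma slope_lin:
  assumes "slope W g"
  shows "lin g"
proof (rule linI)
  note W = line(1)[OF slopeD(1)[OF assms]] and g = slopeD(3)[OF assms]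
  fix x y c
  have "(E x + F (g x)) + (E y + F (g y)) \<in> affine_cone W"
    by (intro vec.subspace_add[OF W] g)
  then have "E (x + y) + F (g x + g y) \<in> affine_cone W"
    unfolding lin_simps[OF linE] lin_simps[OF linF] by (simp add: add_ac)
  then show "g (x + y) = g x + g y" by (rule slope_unique[OF assms, symmetric])
  have "c *s (E x + F (g x)) \<in> affine_cone W"
    by (intro vec.subspace_scale[OF W] g)
  then have "E (c *s x) + F (c *s g x) \<in> affine_cone W"
    unfolding lin_simps[OF linE] lin_simps[OF linF] by (simp add: vec.scale_right_distrib)
  then show "g (c *s x) = c *s g x" by (rule slope_unique[OF assms, symmetric])
qed

lemma slope_A: "slope A (\<lambda>_. 0)" and slope_C: "slope C (\<lambda>x. x)"
  using lines distinct diagonal E_in by (auto simp: slope_def lin_simps[OF linF])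

text \<open>This is fullness in terms of slopes: some line of the spread passes through
  \<open>E x + F y\<close>, and it is not \<open>B\<close> because \<open>x\<close> is
  nonzero.\<close>

lemma slope_cover:
  assumes "x \<noteq> 0"
  obtains W g where "slope W g" "g x = y"
proof -
  obtain W where W: "W \<in> \<L>" "E x + F y \<in> affine_cone W" using cover .
  have "W \<noteq> B"
  proof
    assume "W = B"
    then have "(E x + F y) - F y \<in> affine_cone B" using W F_in line(1) vec.subspace_diff by metis
    then have "E x = 0" using meet[OF lines(1,2) distinct(1) E_in] by simp
    then show False using assms injE by blast
  qed
  then obtain g where "slope W g" using slope_exists W by blast
  then show ?thesis using that slope_unique W by metis
qed

text \<open>Slopes that agree at a nonzero \<open>x\<close> give a common nonzero vector of two
  lines. Thus the difference of the slopes of two distinct lines is injective.\<close>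

lemma slope_eqI:
  assumes "slope W g" "slope W' h" "g x = h x" "x \<noteq> 0"
  shows "W = W'"
proof (rule ccontr)
  assume "W \<noteq> W'"
  then have "E x + F (g x) = 0"
    using meet[OF slopeD(1)[OF assms(1)] slopeD(1)[OF assms(2)]] slopeD(3) assms by metis
  then have "x = 0" using coords_unique(1)[of x "g x" 0 0] by (simp add: lin_simps[OF linE] lin_simps[OF linF])
  then show False using assms by simp
qed

lemma slope_fun_unique: "slope W g \<Longrightarrow> slope W h \<Longrightarrow> g = h"
  using slope_unique slopeD(3) by (metis ext)

text \<open>The arrow is the composite \<open>A \<rightarrow> W \<rightarrow> B \<rightarrow> A\<close> along \<open>B\<close>, \<open>W'\<close> and \<open>C\<close>.\<close>

lemma slope_diff_arrow:
  assumes g: "slope W g" and h: "slope W' h" and ne: "W \<noteq> W'" "W \<noteq> A"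
  obtains f where "arrow \<L> A A f"
    "\<And>x. x \<noteq> 0 \<Longrightarrow> f (vec.span {E x}) = vec.span {E (g x - h x)}"
proof -
  note W = slopeD[OF g] and W' = slopeD[OF h]
  let ?f1 = "line_proj A W B" and ?f2 = "line_proj W B W'" and ?f3 = "line_proj B A C"
  let ?f = "compose A ?f3 (compose A ?f2 ?f1)"
  have "arrow \<L> A W ?f1" "arrow \<L> W B ?f2" "arrow \<L> B A ?f3"
    using W W' ne lines distinct by (auto intro!: arrow_proj)
  then have "arrow \<L> A A ?f" by (intro arrow_comp)
  moreover have "?f (vec.span {E x}) = vec.span {E (g x - h x)}" if "x \<noteq> 0" for x
  proof -
    have x0: "E x \<noteq> 0" using that injE by blast
    have d0: "g x - h x \<noteq> 0" using slope_eqI[OF g h _ that] ne by auto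
    have "E x - (E x + F (g x)) = F (- g x)" by (simp add: lin_simps[OF linF])
    then have 1: "?f1 (vec.span {E x}) = vec.span {E x + F (g x)}" "E x + F (g x) \<noteq> 0"
      using line_proj_span[of A W B "E x" "E x + F (g x)"] lines distinct W ne x0 E_in F_in
      by metis+
    \<comment> \<open>Removing the vector of \<open>W'\<close> over the same \<open>x\<close> leaves
      the difference of the slopes as an element of \<open>B\<close>.\<close>
    have "E x + F (g x) - F (g x - h x) = E x + F (h x)" by (simp add: lin_simps[OF linF])
    then have 2: "?f2 (vec.span {E x + F (g x)}) = vec.span {F (g x - h x)}" "F (g x - h x) \<noteq> 0"
      using line_proj_span[of W B W' "E x + F (g x)" "F (g x - h x)"] lines W W' ne 1 F_in
      by metis+
    let ?y = "g x - h x"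
    have "F ?y - E (- ?y) = E ?y + F ?y" by (simp add: lin_simps[OF linE] add.commute)
    then have "?f3 (vec.span {F ?y}) = vec.span {E (- ?y)}"
      using line_proj_span[of B A C "F ?y" "E (- ?y)"] lines distinct 2 E_in F_in diagonal
      by metis
    \<comment> \<open>Projecting along the diagonal \<open>C\<close> introduces a sign, which does
      not change the point.\<close>
    also have "\<dots> = vec.span {(-1) *s E ?y}" by (simp add: lin_simps[OF linE] vec.scale_right_diff_distrib)
    also have "\<dots> = vec.span {E ?y}" by (rule span_singleton_scale) simp
    finally have 3: "?f3 (vec.span {F ?y}) = vec.span {E ?y}" .
    have "vec.span {E x} \<in> A" using span_in_line_iff[OF lines(1) x0] E_in by blast
    then show ?thesis using 1 2 3 by (simp add: compose_def)
  qed
  ultimately show ?thesis by (rule that)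
qed

end

section \<open>Commuting slopes\<close>

locale abelian_frame4 = frame4 +
  assumes comm: "\<lbrakk>arrow \<L> A A f; arrow \<L> A A g\<rbrakk> \<Longrightarrow> compose A f g = compose A g f"
begin

text \<open>Commuting arrows agree on points, so the two composites of the linear maps are
  proportional at each vector; by \<open>lin_pointwise_proportional\<close> the factor is
  constant.\<close>

lemma slope_diff_commute:
  assumes "slope W g" "slope W' h" "W \<noteq> W'" "W \<noteq> A"
    and "slope V p" "slope V' q" "V \<noteq> V'" "V \<noteq> A"
  obtains c where "\<And>x. g (p x - q x) - h (p x - q x) = c *s (p (g x - h x) - q (g x - h x))"
proof -
  note lg = slope_lin[OF assms(1)] and lh = slope_lin[OF assms(2)]
    and lp = slope_lin[OF assms(5)] and lq = slope_lin[OF assms(6)]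
  let ?M = "\<lambda>x. g x - h x" and ?N = "\<lambda>x. p x - q x"
  have M0: "?M x \<noteq> 0" if "x \<noteq> 0" for x using slope_eqI[OF assms(1,2) _ that] assms by auto
  have N0: "?N x \<noteq> 0" if "x \<noteq> 0" for x using slope_eqI[OF assms(5,6) _ that] assms by auto
  obtain f where f: "arrow \<L> A A f" "\<And>x. x \<noteq> 0 \<Longrightarrow> f (vec.span {E x}) = vec.span {E (?M x)}"
    using slope_diff_arrow[OF assms(1-4)] by blast
  obtain f' where f': "arrow \<L> A A f'" "\<And>x. x \<noteq> 0 \<Longrightarrow> f' (vec.span {E x}) = vec.span {E (?N x)}"
    using slope_diff_arrow[OF assms(5-8)] by blast
  have pw: "\<exists>c. ?M (?N x) = c *s ?N (?M x)" if "x \<noteq> 0" for x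
  proof -
    have "E x \<noteq> 0" using that injE by blast
    then have "vec.span {E x} \<in> A" using span_in_line_iff[OF lines(1)] E_in by blast
    then have "vec.span {E (?M (?N x))} = compose A f f' (vec.span {E x})"
      using f f' that N0 by (simp add: compose_def)
    also have "\<dots> = compose A f' f (vec.span {E x})" using comm[OF f(1) f'(1)] by simp
    also have "\<dots> = vec.span {E (?N (?M x))}"
      using f f' that M0 \<open>vec.span {E x} \<in> A\<close> by (simp add: compose_def)
    finally have "E (?M (?N x)) \<in> vec.span {E (?N (?M x))}"
      by (metis vec.span_base singletonI)
    then obtain c where "E (?M (?N x)) = E (c *s ?N (?M x))"
      unfolding lin_simps(2)[OF linE] by (auto simp: vec.span_singleton)
    then show ?thesis using coords_unique(1)[of _ 0 _ 0] by auto
  qed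
  have lM: "lin ?M" and lN: "lin ?N"
    using lg lh lp lq vec.linear_compose_sub by blast+
  have l: "lin (\<lambda>x. ?M (?N x))" "lin (\<lambda>x. ?N (?M x))"
    by (rule linI; simp only: lin_simps[OF lM] lin_simps[OF lN])+
  have "x = 0" if "?N (?M x) = 0" for x using that M0 N0 by metis
  from lin_pointwise_proportional[OF l this pw] that show ?thesis by metis
qed

lemma slope_commute:
  assumes g: "slope W g" and h: "slope V h"
  shows "g (h x) = h (g x)"
\<comment> \<open>In these cases \<open>g\<close>, \<open>g - 1\<close> or \<open>h\<close> is the
  zero map and induces no arrow; the claim is then immediate.\<close>
proof (cases "W = A \<or> W = C \<or> V = A")
  case True
  then have "g = (\<lambda>_. 0) \<or> g = (\<lambda>x. x) \<or> h = (\<lambda>_. 0)"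
    using slope_fun_unique[OF g] slope_fun_unique[OF h] slope_A slope_C by blast
  then show ?thesis using lin_simps(5)[OF slope_lin[OF g]] lin_simps(5)[OF slope_lin[OF h]] by auto
next
  case False
  note lg = slope_lin[OF g] and lh = slope_lin[OF h]
  obtain c where c: "\<And>x. g (h x) = c *s h (g x)"
    using slope_diff_commute[OF g slope_A _ _ h slope_A] False by auto
  obtain d where d: "\<And>x. g (h x) - h x = d *s h (g x - x)"
    using slope_diff_commute[OF g slope_C _ _ h slope_A] False by auto
  have h0: "y = 0" if "h y = 0" for y
    using slope_eqI[OF h slope_A] that False by metis
  \<comment> \<open>\<open>gh = c hg\<close> and \<open>(g - 1) h = d h (g - 1)\<close>; cancel \<open>h\<close> in the difference.\<close>
  have key: "(c - d) *s g y = (1 - d) *s y" for y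
  proof -
    have "c *s h (g y) - h y = d *s (h (g y) - h y)"
      using c[of y] d[of y] lin_simps(3)[OF lh] by metis
    then have "h ((c - d) *s g y - (1 - d) *s y) = 0"
      unfolding lin_simps[OF lh] by (simp add: vec_eq_iff algebra_simps)
    then show ?thesis using h0 by fastforce
  qed
  show ?thesis
  \<comment> \<open>If \<open>c = d\<close>, the identity \<open>key\<close> forces
    \<open>d = 1\<close>, hence \<open>c = 1\<close>. Otherwise it exhibits \<open>g\<close> as a
    scalar, which commutes with the linear map \<open>h\<close>.\<close>
  proof (cases "c = d")
    case True
    then have "(1 - d) *s axis 1 1 = (0 :: 'a ^ 2)" using key[of "axis 1 1"] by simp
    then have "d = 1" by (auto simp: vec_eq_iff axis_def forall_2)
    then show ?thesis using c True by simp
  next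
    case False
    then have "g y = ((1 - d) / (c - d)) *s y" for y
      using key[of y] by (simp add: vec_eq_iff field_simps)
    then show ?thesis using lin_simps(2)[OF lh] by metis
  qed
qed

end

section \<open>An operator with nonsquare square that preserves every line\<close>

context abelian_frame4
begin

lemma quadratic_structure_exists:
  assumes two: "(2::'a) \<noteq> 0"
  obtains \<Theta> m where "lin \<Theta>" "\<And>v. \<Theta> (\<Theta> v) = m *s v" "\<And>c. c * c \<noteq> m"
    "\<And>V v. \<lbrakk>V \<in> \<L>; v \<in> affine_cone V\<rbrakk> \<Longrightarrow> \<Theta> v \<in> affine_cone V"
proof -
  let ?e = "axis 1 1 :: 'a^2" and ?d = "axis 2 1 :: 'a^2"
  have e0: "?e \<noteq> 0" by (simp add: axis_eq_0_iff)
  \<comment> \<open>This slope is not scalar: \<open>?e\<close> and \<open>a ?e = ?d\<close> form a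
    basis, so a map commuting with \<open>a\<close> is determined by its value at
    \<open>?e\<close>.\<close>
  obtain W a where W: "slope W a" and ae: "a ?e = ?d" using slope_cover[OF e0] .
  note la = slope_lin[OF W]
  have xe: "x$1 *s ?e + x$2 *s ?d = x" and xa: "x$1 *s ?d + x$2 *s a ?d = a x" for x
    using vec2_expand[of x] lin_axis[OF la, of x] ae by simp_all
  have slope_form: "g x = (g ?e)$1 *s x + (g ?e)$2 *s a x" if g: "slope V g" for V g x
  proof -
    note lg = slope_lin[OF g]
    let ?p = "(g ?e)$1" and ?q = "(g ?e)$2"
    have ge: "g ?e = ?p *s ?e + ?q *s ?d" by (rule vec2_expand)
    have "g ?d = a (g ?e)" using slope_commute[OF W g, of ?e] ae by simp
    also have "\<dots> = ?p *s ?d + ?q *s a ?d"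
      by (subst ge) (simp only: lin_simps(1,2)[OF la] ae)
    finally have gd: "g ?d = ?p *s ?d + ?q *s a ?d" .
    have "g x = x$1 *s (?p *s ?e + ?q *s ?d) + x$2 *s (?p *s ?d + ?q *s a ?d)"
      unfolding lin_axis[OF lg, of x] gd by (subst ge) (rule refl)
    also have "\<dots> = ?p *s (x$1 *s ?e + x$2 *s ?d) + ?q *s (x$1 *s ?d + x$2 *s a ?d)"
      by (simp add: vec_eq_iff algebra_simps)
    also have "\<dots> = ?p *s x + ?q *s a x"
      unfolding xe xa ..
    finally show ?thesis .
  qed
  \<comment> \<open>Conversely, fullness gives a slope with any prescribed value at
    \<open>?e\<close>, so every \<open>p + q a\<close> occurs.\<close>
  have slope_all: "\<exists>V. slope V (\<lambda>x. p *s x + q *s a x)" for p q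
  proof -
    obtain V g where g: "slope V g" "g ?e = p *s ?e + q *s ?d" using slope_cover[OF e0] .
    have pq: "(g ?e)$1 = p" "(g ?e)$2 = q" using g(2) by (auto simp: axis_def)
    have "g = (\<lambda>x. p *s x + q *s a x)"
      by (rule ext) (use slope_form[OF g(1), unfolded pq] in blast)
    then show ?thesis using g(1) by blast
  qed
  \<comment> \<open>The relation \<open>a^2 = n + t a\<close> is read off from \<open>a ?d\<close>
    and checked on the basis \<open>?e\<close>, \<open>?d = a ?e\<close>.\<close>
  define n where "n = (a ?d)$1"
  define t where "t = (a ?d)$2"
  have ad: "a ?d = n *s ?e + t *s ?d" unfolding n_def t_def by (rule vec2_expand)
  have aad: "a (a ?d) = n *s ?d + t *s a ?d"
    by (subst ad) (simp only: lin_simps(1,2)[OF la] ae)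
  have aa: "a (a x) = n *s x + t *s a x" for x
  proof -
    have "a (a x) = x$1 *s a ?d + x$2 *s a (a ?d)"
      unfolding lin_axis[OF la, of x] by (simp only: lin_simps(1,2)[OF la] ae)
    also have "\<dots> = x$1 *s (n *s ?e + t *s ?d) + x$2 *s (n *s ?d + t *s a ?d)"
      by (subst aad, subst ad) (rule refl)
    also have "\<dots> = n *s (x$1 *s ?e + x$2 *s ?d) + t *s (x$1 *s ?d + x$2 *s a ?d)"
      by (simp add: vec_eq_iff algebra_simps)
    also have "\<dots> = n *s x + t *s a x"
      unfolding xe xa ..
    finally show ?thesis .
  qed
  \<comment> \<open>Completing the square, with 2 invertible: \<open>T = a - t/2\<close> satisfies
    \<open>T^2 = m\<close>.\<close>
  define s where "s = - (t / 2)"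
  have s: "s + s = - t" using two by (simp add: s_def flip: mult_2)
  define T where "T x = s *s x + a x" for x
  define m where "m = n + s * s"
  have slope_T: "\<exists>V. slope V (\<lambda>x. c *s x + T x)" for c
    using slope_all[of "c + s" 1] by (simp add: T_def vec.scale_left_distrib add.assoc)
  then obtain V where V: "slope V T" by (metis (no_types, lifting) ext add_0 vec.scale_zero_left)
  note lT = slope_lin[OF V]
  have TT: "T (T x) = m *s x" for x
  proof -
    have "T (T x) = (s * s) *s x + (s + s) *s a x + a (a x)"
      unfolding T_def lin_simps(1,2)[OF la] by (simp add: vec_eq_iff algebra_simps)
    then show ?thesis unfolding aa s m_def by (simp add: vec_eq_iff algebra_simps)
  qed
  \<comment> \<open>If \<open>m = c^2\<close>, then \<open>(T - c)(T + c) = 0\<close>. As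
    \<open>T + c\<close> is nonzero at \<open>?e\<close>, the slope \<open>T - c\<close> vanishes at
    a nonzero vector, so it is the slope 0 of \<open>A\<close>; but it is nonzero at
    \<open>?e\<close> too.\<close>
  have nsq: "c * c \<noteq> m" for c
  proof
    assume c: "c * c = m"
    have T_nz: "k *s ?e + T ?e \<noteq> 0" for k
      unfolding T_def ae by (simp add: vec_eq_iff axis_def forall_2)
    obtain U where U: "slope U (\<lambda>x. (- c) *s x + T x)" using slope_T by blast
    have "(- c) *s (c *s ?e + T ?e) + T (c *s ?e + T ?e) = 0"
      unfolding lin_simps(1,2)[OF lT] TT c[symmetric] by (simp add: vec_eq_iff algebra_simps)
    then have "U = A" using slope_eqI[OF U slope_A _ T_nz[of c]] by blast
    then have "(\<lambda>x. (- c) *s x + T x) = (\<lambda>_. 0)" using slope_fun_unique U slope_A by blast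
    then show False using T_nz[of "- c"] by metis
  qed
  have "\<exists>x y. v = E x + F y" for v using coords by metis
  then obtain X Y where XY: "\<And>v. v = E (X v) + F (Y v)" by metis
  define \<Theta> where "\<Theta> v = E (T (X v)) + F (T (Y v))" for v
  have \<Theta>: "\<Theta> (E x + F y) = E (T x) + F (T y)" for x y
    using coords_unique[OF XY[of "E x + F y"]] by (simp add: \<Theta>_def)
  have "lin \<Theta>"
  proof (rule linI)
    fix v w c
    have "v + w = E (X v + X w) + F (Y v + Y w)"
      using XY[of v] XY[of w] unfolding lin_simps(1)[OF linE] lin_simps(1)[OF linF]
      by (metis add.assoc add.left_commute)
    then have "\<Theta> (v + w) = E (T (X v + X w)) + F (T (Y v + Y w))" by (simp add: \<Theta>)
    then show "\<Theta> (v + w) = \<Theta> v + \<Theta> w"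
      unfolding \<Theta>_def by (simp add: lin_simps(1)[OF linE] lin_simps(1)[OF linF] lin_simps(1)[OF lT])
    have "c *s v = E (c *s X v) + F (c *s Y v)"
      using XY[of v] unfolding lin_simps(2)[OF linE] lin_simps(2)[OF linF]
      by (metis vec.scale_right_distrib)
    then have "\<Theta> (c *s v) = E (T (c *s X v)) + F (T (c *s Y v))" by (simp add: \<Theta>)
    then show "\<Theta> (c *s v) = c *s \<Theta> v"
      unfolding \<Theta>_def by (simp add: lin_simps(2)[OF linE] lin_simps(2)[OF linF] lin_simps(2)[OF lT]
          vec.scale_right_distrib)
  qed
  moreover have "\<Theta> (\<Theta> v) = m *s v" for v
  proof -
    have "\<Theta> (\<Theta> v) = E (m *s X v) + F (m *s Y v)"
      unfolding \<Theta>_def[of v] \<Theta> TT ..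
    also have "\<dots> = m *s (E (X v) + F (Y v))"
      by (simp add: lin_simps(2)[OF linE] lin_simps(2)[OF linF] vec.scale_right_distrib)
    finally show ?thesis using XY[of v] by simp
  qed
  \<comment> \<open>On \<open>B\<close> only the second coordinate occurs. The graph of a slope
    \<open>g\<close> is preserved because \<open>T\<close> is itself a slope and commutes with
    \<open>g\<close>.\<close>
  moreover have "\<Theta> v \<in> affine_cone U" if U: "U \<in> \<L>" "v \<in> affine_cone U" for U v
  proof (cases "U = B")
    case True
    then obtain y where "v = F y" using U ranF by (metis imageE)
    then have "v = E 0 + F y" by (simp add: lin_simps(5)[OF linE])
    then have "\<Theta> v = F (T y)" using \<Theta>[of 0 y] by (simp add: lin_simps(5)[OF linE] lin_simps(5)[OF lT])
    then show ?thesis using True F_in by simp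
  next
    case False
    then obtain g where g: "slope U g" using slope_exists U by blast
    obtain x y where v: "v = E x + F y" using coords .
    then have "y = g x" using slope_unique[OF g] U by simp
    then have "\<Theta> v = E (T x) + F (g (T x))" using \<Theta> v slope_commute[OF V g] by simp
    then show ?thesis using slopeD(3)[OF g] by simp
  qed
  ultimately show ?thesis using nsq that by blast
qed

end

section \<open>Quadratic structures and invariant spreads\<close>

text \<open>Such a \<Theta> makes \<open>K^4\<close> a plane over the field obtained by adjoining a
  square root of \<open>m\<close>, with \<Theta> as multiplication by that root.\<close>

locale quadratic_structure =
  fixes \<Theta> :: "'k::field ^ 4 \<Rightarrow> 'k ^ 4" and m :: 'k
  assumes lin_\<Theta>: "lin \<Theta>" and \<Theta>_\<Theta>: "\<Theta> (\<Theta> v) = m *s v" and nonsquare: "c * c \<noteq> m"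
begin

text \<open>The pair \<open>(a, b)\<close> stands for the scalar
  \<open>a + b sqrt m\<close>.\<close>

definition qmul :: "'k \<times> 'k \<Rightarrow> 'k ^ 4 \<Rightarrow> 'k ^ 4" where
  "qmul z v = fst z *s v + snd z *s \<Theta> v"

lemma lin_qmul: "lin (qmul z)"
  by (rule linI) (auto simp: qmul_def lin_simps(1,2)[OF lin_\<Theta>] vec_eq_iff algebra_simps)

text \<open>A nontrivial relation would make \<open>v\<close> an eigenvector of \<Theta>; its
  eigenvalue \<open>c\<close> would satisfy \<open>c^2 = m\<close>.\<close>

lemma qmul_eq_0_iff: "qmul z v = 0 \<longleftrightarrow> z = 0 \<or> v = 0"
proof
  assume z: "qmul z v = 0"
  show "z = 0 \<or> v = 0"
  proof (rule ccontr)
    assume n: "\<not> (z = 0 \<or> v = 0)"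
    have b: "snd z \<noteq> 0"
      using z n by (auto simp: qmul_def prod_eq_iff)
    define c where "c = - fst z / snd z"
    have "snd z *s \<Theta> v = - (fst z *s v)" using z by (simp add: qmul_def add_eq_0_iff)
    then have "\<Theta> v = c *s v"
      using b by (simp add: c_def vec_eq_iff field_simps)
    then have "m *s v = (c * c) *s v"
      using \<Theta>_\<Theta>[of v] lin_simps(2)[OF lin_\<Theta>] by (metis vec.scale_scale)
    then show False using n nonsquare[of c] by (metis vec.scale_right_imp_eq)
  qed
qed (auto simp: qmul_def lin_simps(5)[OF lin_\<Theta>])

lemma qmul_scale: "c *s qmul z v = qmul (c * fst z, c * snd z) v"
  and qmul_diff: "qmul z v - qmul w v = qmul (z - w) v"
  and qmul_add: "qmul z v + qmul w v = qmul (z + w) v"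
  and qmul_qmul: "qmul z (qmul w v) = qmul (fst z * fst w + m * snd z * snd w, fst z * snd w + snd z * fst w) v"
  by (auto simp: qmul_def lin_simps(1,2)[OF lin_\<Theta>] \<Theta>_\<Theta> vec_eq_iff algebra_simps)

lemma qmul_commute: "qmul z (qmul w v) = qmul w (qmul z v)"
  by (simp add: qmul_qmul algebra_simps)

lemma qmul_inject: "v \<noteq> 0 \<Longrightarrow> qmul z v = qmul w v \<longleftrightarrow> z = w"
  using qmul_eq_0_iff[of "z - w" v] by (simp flip: qmul_diff)

lemma qmul_1 [simp]: "qmul (1, 0) v = v"
  by (simp add: qmul_def)

lemma qmul_image_span: "qmul z ` vec.span {v} = vec.span {qmul z v}"
  using vec.linear_span_image[OF lin_qmul, of z "{v}"] by simp

definition qline :: "'k ^ 4 \<Rightarrow> ('k ^ 4) set" where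
  "qline v = range (\<lambda>z. qmul z v)"

lemma qmul_in_qline [simp]: "qmul z v \<in> qline v"
  by (simp add: qline_def)

lemma subspace_qline: "vec.subspace (qline v)"
proof (rule vec.subspaceI)
  have "qmul 0 v = 0" by (simp add: qmul_eq_0_iff)
  then show "0 \<in> qline v" using qmul_in_qline[of 0 v] by simp
qed (auto simp: qline_def qmul_add qmul_scale)

text \<open>As \<Theta> has no eigenvector, \<open>v\<close> and \<open>\<Theta> v\<close> are
  independent and hence a basis of \<open>U\<close>.\<close>

lemma subspace_dim2_eq_qline:
  assumes "vec.subspace U" "vec.dim U = 2" "\<And>v. v \<in> U \<Longrightarrow> \<Theta> v \<in> U" "v \<in> U" "v \<noteq> 0"
  shows "U = qline v"
proof
  show "qline v \<subseteq> U"
    using assms by (auto simp: qline_def qmul_def intro!: vec.subspace_add vec.subspace_scale)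
  have nin: "\<Theta> v \<notin> vec.span {v}"
  proof
    assume "\<Theta> v \<in> vec.span {v}"
    then obtain c where "\<Theta> v = c *s v" by (auto simp: vec.span_singleton)
    then have "qmul (- c, 1) v = 0" by (simp add: qmul_def)
    then show False using assms(5) by (simp add: qmul_eq_0_iff prod_eq_iff)
  qed
  then have "vec.independent {\<Theta> v, v}" "\<Theta> v \<noteq> v"
    using assms(5) vec.span_base[of v "{v}"] by (auto simp: vec.independent_insert)
  then have "U \<subseteq> vec.span {\<Theta> v, v}"
    using vec.card_eq_dim[of "{\<Theta> v, v}" U] assms by simp
  also have "\<dots> \<subseteq> qline v"
  proof
    fix u assume "u \<in> vec.span {\<Theta> v, v}"
    then obtain k l where "u = k *s \<Theta> v + l *s v"
      by (auto simp: vec.span_insert vec.span_singleton algebra_simps)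
    then have "u = qmul (l, k) v" by (simp add: qmul_def add.commute)
    then show "u \<in> qline v" by simp
  qed
  finally show "U \<subseteq> qline v" .
qed

end

section \<open>Arrows of a spread with invariant lines\<close>

locale invariant_spread = spread4 \<L> + quadratic_structure \<Theta> m
  for \<L> :: "('k::field ^ 4) set set set" and \<Theta> :: "'k ^ 4 \<Rightarrow> 'k ^ 4" and m :: 'k +
  assumes invariant: "L \<in> \<L> \<Longrightarrow> v \<in> affine_cone L \<Longrightarrow> \<Theta> v \<in> affine_cone L"
begin

lemma cone_eq_qline:
  assumes "L \<in> \<L>" "v \<in> affine_cone L" "v \<noteq> 0"
  shows "affine_cone L = qline v"
  using subspace_dim2_eq_qline line invariant assms by metis

lemma qmul_in_cone: "L \<in> \<L> \<Longrightarrow> v \<in> affine_cone L \<Longrightarrow> qmul z v \<in> affine_cone L"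
  unfolding qmul_def by (intro vec.subspace_add vec.subspace_scale invariant line(1))

text \<open>Multiplication by \<open>z\<close> preserves the cone of \<open>N\<close>, so the
  relation \<open>v - w\<close> in \<open>N\<close> may be multiplied by \<open>z\<close>:
  projections are linear over \<open>K[\<Theta>]\<close>.\<close>

lemma line_proj_qmul:
  assumes L: "L \<in> \<L>" and M: "M \<in> \<L>" and N: "N \<in> \<L>"
    and ne: "L \<noteq> M" "L \<noteq> N" "M \<noteq> N"
    and v: "v \<in> affine_cone L" "v \<noteq> 0" and w: "w \<in> affine_cone M" "v - w \<in> affine_cone N"
    and z: "z \<noteq> 0"
  shows "line_proj L M N (vec.span {qmul z v}) = vec.span {qmul z w}" "w \<noteq> 0"
proof -
  have "qmul z v - qmul z w = qmul z (v - w)" by (simp add: lin_simps(3)[OF lin_qmul])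
  then have "qmul z v - qmul z w \<in> affine_cone N" using qmul_in_cone[OF N w(2)] by simp
  then show "line_proj L M N (vec.span {qmul z v}) = vec.span {qmul z w}"
    using line_proj_span(1)[OF L M N ne qmul_in_cone[OF L v(1)] _ qmul_in_cone[OF M w(1)]]
    by (simp add: qmul_eq_0_iff v(2) z)
  show "w \<noteq> 0" by (rule line_proj_span(2)[OF L M N ne v w])
qed

text \<open>Arrows are induced by \<open>K[\<Theta>]\<close>-linear maps. Lines are one-dimensional
  over \<open>K[\<Theta>]\<close>, so an arrow is described by the image \<open>w\<close> of a
  single vector \<open>v\<close>. Extensionality is carried along to recover equality of functions
  later.\<close>

lemma arrow_qmul:
  assumes "arrow \<L> L M f"
  shows "L \<in> \<L> \<and> M \<in> \<L> \<and> f \<in> extensional L \<and>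
    (\<forall>v\<in>affine_cone L. v \<noteq> 0 \<longrightarrow> (\<exists>w\<in>affine_cone M. w \<noteq> 0 \<and>
      (\<forall>z. z \<noteq> 0 \<longrightarrow> f (vec.span {qmul z v}) = vec.span {qmul z w})))"
  using assms
proof induction
  case (arrow_id L)
  have "vec.span {qmul z v} \<in> L" if "v \<in> affine_cone L" "v \<noteq> 0" "z \<noteq> 0" for z v
    using that arrow_id span_in_line_iff qmul_in_cone qmul_eq_0_iff by metis
  then show ?case using arrow_id by (auto simp: extensional_def)
next
  case (arrow_proj L M N)
  have "\<exists>w\<in>affine_cone M. w \<noteq> 0 \<and>
      (\<forall>z. z \<noteq> 0 \<longrightarrow> line_proj L M N (vec.span {qmul z v}) = vec.span {qmul z w})"
    if "v \<in> affine_cone L" "v \<noteq> 0" for v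
  proof -
    obtain w n where w: "w \<in> affine_cone M" "n \<in> affine_cone N" "v = w + n"
      using decomp[OF arrow_proj(2,3,6)] .
    then have "v - w \<in> affine_cone N" by simp
    note * = line_proj_qmul[OF arrow_proj that w(1) this]
    have "w \<noteq> 0" by (rule *(2)[of "(1, 0)"]) (simp add: zero_prod_def)
    then show ?thesis using *(1) w(1) by blast
  qed
  moreover have "line_proj L M N \<in> extensional L" by (simp add: line_proj_def)
  ultimately show ?case using arrow_proj(1,2) by blast
next
  case (arrow_comp L M f N g)
  have "\<exists>u\<in>affine_cone N. u \<noteq> 0 \<and>
      (\<forall>z. z \<noteq> 0 \<longrightarrow> compose L g f (vec.span {qmul z v}) = vec.span {qmul z u})"
    if v: "v \<in> affine_cone L" "v \<noteq> 0" for v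
  proof -
    obtain w where w: "w\<in>affine_cone M" "w \<noteq> 0"
      "\<And>z. z \<noteq> 0 \<Longrightarrow> f (vec.span {qmul z v}) = vec.span {qmul z w}"
      using arrow_comp v by metis
    obtain u where u: "u\<in>affine_cone N" "u \<noteq> 0"
      "\<And>z. z \<noteq> 0 \<Longrightarrow> g (vec.span {qmul z w}) = vec.span {qmul z u}"
      using arrow_comp w by metis
    have "vec.span {qmul z v} \<in> L" if "z \<noteq> 0" for z
      using that arrow_comp v span_in_line_iff qmul_in_cone qmul_eq_0_iff by metis
    then show ?thesis using u w by (auto simp: compose_def intro!: bexI[of _ u])
  qed
  then show ?case using arrow_comp by simp
qed

definition qmulap :: "('k ^ 4) set set \<Rightarrow> 'k \<times> 'k \<Rightarrow> ('k ^ 4) set \<Rightarrow> ('k ^ 4) set" where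
  "qmulap L z = (\<lambda>p\<in>L. qmul z ` p)"

lemma qmulap_span:
  assumes "L \<in> \<L>" "v \<in> affine_cone L" "v \<noteq> 0"
  shows "qmulap L z (vec.span {v}) = vec.span {qmul z v}"
  using assms span_in_line_iff qmul_image_span by (simp add: qmulap_def)

lemma qmulap_eqI:
  assumes "L \<in> \<L>" "f \<in> extensional L"
    and "\<And>v. v \<in> affine_cone L \<Longrightarrow> v \<noteq> 0 \<Longrightarrow> f (vec.span {v}) = vec.span {qmul z v}"
  shows "f = qmulap L z"
proof (rule extensionalityI[OF assms(2)])
  show "qmulap L z \<in> extensional L" by (simp add: qmulap_def)
  fix p assume "p \<in> L"
  then obtain v where "v \<noteq> 0" "v \<in> affine_cone L" "p = vec.span {v}" using lineE assms(1) by blast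
  then show "f p = qmulap L z p" using assms qmulap_span by simp
qed

text \<open>Write \<open>v = w + n\<close> along \<open>M\<close> and \<open>N\<close>. Projecting
  from \<open>L\<close> to \<open>M\<close> along the line through \<open>v - z w\<close> sends
  \<open>v\<close> to \<open>z w\<close>; returning along \<open>N\<close> sends \<open>w\<close> to
  \<open>v\<close>. By linearity the composite is multiplication by \<open>z\<close>.\<close>

lemma qmulap_arrow:
  assumes L: "L \<in> \<L>" and z: "z \<noteq> 0"
  shows "arrow \<L> L L (qmulap L z)"
proof -
  obtain M N where MN: "M \<in> \<L>" "N \<in> \<L>" "L \<noteq> M" "L \<noteq> N" "M \<noteq> N"
    using two_more_lines[OF L] .
  obtain v where v: "v \<in> affine_cone L" "v \<noteq> 0" using nonzero_in_line[OF L] .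
  obtain w n where wn: "w \<in> affine_cone M" "n \<in> affine_cone N" "v = w + n"
    using decomp[OF MN(1,2,5)] .
  have vw: "v - w \<in> affine_cone N" using wn by simp
  then have "(-1) *s (v - w) \<in> affine_cone N" by (rule vec.subspace_scale[OF line(1)[OF MN(2)]])
  then have wv: "w - v \<in> affine_cone N" by simp
  have w0: "w \<noteq> 0" using line_proj_span(2)[OF L MN v wn(1) vw] .
  obtain P where P: "P \<in> \<L>" "v - qmul z w \<in> affine_cone P" using cover .
  have LP: "L \<noteq> P"
  proof
    assume "L = P"
    then have "v - (v - qmul z w) \<in> affine_cone L" using P v line(1) vec.subspace_diff by metis
    then have "qmul z w = 0" using meet[OF L MN(1,3)] qmul_in_cone[OF MN(1) wn(1)] by simp
    then show False using z w0 by (simp add: qmul_eq_0_iff)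
  qed
  have MP: "M \<noteq> P"
  proof
    assume "M = P"
    then have "(v - qmul z w) + qmul z w \<in> affine_cone M"
      using P qmul_in_cone[OF MN(1) wn(1)] line(1) vec.subspace_add by metis
    then show False using meet[OF L MN(1,3) v(1)] v(2) by simp
  qed
  let ?f = "compose L (line_proj M L N) (line_proj L M P)"
  have "arrow \<L> L M (line_proj L M P)" "arrow \<L> M L (line_proj M L N)"
    using L MN P LP MP by (auto intro!: arrow_proj)
  then have f: "arrow \<L> L L ?f" by (rule arrow_comp)
  moreover have "?f = qmulap L z"
  proof (rule qmulap_eqI[OF L])
    show "?f \<in> extensional L" by simp
    fix u assume u: "u \<in> affine_cone L" "u \<noteq> 0"
    then obtain y where y: "u = qmul y v" using cone_eq_qline[OF L v] by (auto simp: qline_def)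
    then have y0: "y \<noteq> 0" "qmul y (qmul z w) \<noteq> 0" using u z w0 by (auto simp: qmul_eq_0_iff)
    have 1: "line_proj L M P (vec.span {qmul y v}) = vec.span {qmul y (qmul z w)}"
      by (rule line_proj_qmul(1)[OF L MN(1) P(1) MN(3) LP MP v qmul_in_cone[OF MN(1) wn(1)] P(2) y0(1)])
    \<comment> \<open>Here \<open>x\<close> is the product of \<open>y\<close> and \<open>z\<close>
      in \<open>K[\<Theta>]\<close>.\<close>
    obtain x where x: "qmul y (qmul z w) = qmul x w" "x \<noteq> 0" using qmul_qmul y0 by (metis qmul_eq_0_iff)
    have "line_proj M L N (vec.span {qmul x w}) = vec.span {qmul x v}"
      by (rule line_proj_qmul(1)[OF MN(1) L MN(2) MN(3)[symmetric] MN(5,4) wn(1) w0 v(1) wv x(2)])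
    moreover have "qmul x v = qmul z u"
    proof -
      have "x = (fst y * fst z + m * snd y * snd z, fst y * snd z + snd y * fst z)"
        using x(1) w0 by (simp add: qmul_qmul qmul_inject)
      then have "qmul x v = qmul y (qmul z v)" by (simp add: qmul_qmul)
      then show ?thesis using y qmul_commute by simp
    qed
    ultimately show "?f (vec.span {u}) = vec.span {qmul z u}"
      using 1 x y u span_in_line_iff[OF L u(2)] by (simp add: compose_def)
  qed
  ultimately show ?thesis by simp
qed

text \<open>A loop sends \<open>v\<close> to a vector of the same \<open>K[\<Theta>]\<close>-line,
  that is to \<open>z v\<close>; by \<open>arrow_qmul\<close> this \<open>z\<close> is the
  multiplier everywhere.\<close>

lemma arrow_loop_iff:
  assumes L: "L \<in> \<L>"
  shows "arrow \<L> L L f \<longleftrightarrow> (\<exists>z. z \<noteq> 0 \<and> f = qmulap L z)"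
proof
  assume f: "arrow \<L> L L f"
  obtain v where v: "v \<in> affine_cone L" "v \<noteq> 0" using nonzero_in_line[OF L] .
  obtain w where w: "w\<in>affine_cone L" "w \<noteq> 0"
    "\<And>z. z \<noteq> 0 \<Longrightarrow> f (vec.span {qmul z v}) = vec.span {qmul z w}"
    using arrow_qmul[OF f] v by metis
  obtain z where z: "w = qmul z v" using w(1) cone_eq_qline[OF L v] by (auto simp: qline_def)
  have "f = qmulap L z"
  proof (rule qmulap_eqI[OF L])
    show "f \<in> extensional L" using arrow_qmul[OF f] by blast
    fix u assume u: "u \<in> affine_cone L" "u \<noteq> 0"
    then obtain y where y: "u = qmul y v" using cone_eq_qline[OF L v] by (auto simp: qline_def)
    then have "y \<noteq> 0" using u by (auto simp: qmul_eq_0_iff)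
    then show "f (vec.span {u}) = vec.span {qmul z u}" using w(3) y z qmul_commute by simp
  qed
  moreover have "z \<noteq> 0" using z w(2) by (auto simp: qmul_eq_0_iff)
  ultimately show "\<exists>z. z \<noteq> 0 \<and> f = qmulap L z" by blast
qed (auto intro: qmulap_arrow L)

end

section \<open>The group of an invariant spread\<close>

text \<open>This is \<open>K[X]/(X^2 - m)\<close> on pairs, in the form of an algebraic structure to
  which the theorem on multiplicative groups of finite fields applies.\<close>

definition quadratic_ring :: "'k::field \<Rightarrow> ('k \<times> 'k) ring" where
  "quadratic_ring m = \<lparr>carrier = UNIV,
     mult = (\<lambda>z w. (fst z * fst w + m * snd z * snd w, fst z * snd w + snd z * fst w)),
     one = (1, 0), zero = 0, add = (+)\<rparr>"

text \<open>The inverse of \<open>a + b sqrt m\<close> is its conjugate divided by the norm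
  \<open>d = a^2 - m b^2\<close>, which is nonzero because \<open>m\<close> is not a square.\<close>

lemma field_quadratic_ring:
  assumes nonsquare: "\<And>c. c * c \<noteq> m"
  shows "field (quadratic_ring m)"
proof (rule cring.cring_fieldI)
  have "abelian_group (quadratic_ring m)"
  proof (rule abelian_groupI)
    fix z :: "'a \<times> 'a"
    show "\<exists>w\<in>carrier (quadratic_ring m). w \<oplus>\<^bsub>quadratic_ring m\<^esub> z = \<zero>\<^bsub>quadratic_ring m\<^esub>"
      by (rule bexI[of _ "- z"]) (simp_all add: quadratic_ring_def)
  qed (auto simp: quadratic_ring_def add_ac)
  moreover have "Group.comm_monoid (quadratic_ring m)"
    by (rule comm_monoidI) (auto simp: quadratic_ring_def algebra_simps)
  ultimately show cring: "cring (quadratic_ring m)"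
    by (rule cringI) (auto simp: quadratic_ring_def algebra_simps)
  interpret cring "quadratic_ring m" by (fact cring)
  have inv: "z \<in> Units (quadratic_ring m)" if "z \<noteq> 0" for z
  proof -
    obtain a b where z: "z = (a, b)" by force
    define d where "d = a * a - m * (b * b)"
    have "d \<noteq> 0"
    proof
      assume d: "d = 0"
      show False
      proof (cases "b = 0")
        case True
        then show False using d that z by (simp add: d_def zero_prod_def)
      next
        case False
        then have "(a / b) * (a / b) = m" using d by (simp add: d_def field_simps)
        then show False using nonsquare by blast
      qed
    qed
    have "a * (a / d) + m * b * (- b / d) = d / d"
      by (simp add: d_def[symmetric] diff_divide_distrib[symmetric] mult.assoc)
    then have 1: "a * (a / d) + m * b * (- b / d) = 1" "a * (- b / d) + b * (a / d) = 0"
      using \<open>d \<noteq> 0\<close> by simp_all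
    show ?thesis
      unfolding Units_def
      by (rule CollectI, rule conjI, simp add: quadratic_ring_def, rule bexI[of _ "(a / d, - b / d)"])
        (use 1 in \<open>simp_all add: quadratic_ring_def z algebra_simps\<close>)
  qed
  have "0 \<notin> Units (quadratic_ring m)"
    by (auto simp: Units_def quadratic_ring_def)
  then show "Units (quadratic_ring m) = carrier (quadratic_ring m) - {\<zero>\<^bsub>quadratic_ring m\<^esub>}"
    using inv by (auto simp: quadratic_ring_def)
qed

text \<open>Passes from a generator with natural exponents to integer exponents, as
  \<open>cyclic_group\<close> demands.\<close>

lemma (in field) cyclic_group_mult_of:
  assumes "finite (carrier R)"
  shows "cyclic_group (mult_of R)"
proof -
  interpret M: group "mult_of R" by (rule field_mult_group)
  obtain a where a: "a \<in> carrier (mult_of R)" "carrier (mult_of R) = {a [^] i |i::nat. i \<in> UNIV}"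
    using finite_field_mult_group_has_gen[OF assms] by blast
  have "carrier (mult_of R) = range (\<lambda>n::int. a [^]\<^bsub>mult_of R\<^esub> n)"
  proof
    show "carrier (mult_of R) \<subseteq> range (\<lambda>n::int. a [^]\<^bsub>mult_of R\<^esub> n)"
    proof
      fix x assume "x \<in> carrier (mult_of R)"
      then obtain i :: nat where "x = a [^] i" using a by blast
      then have "x = a [^]\<^bsub>mult_of R\<^esub> int i" by (simp add: int_pow_int nat_pow_mult_of)
      then show "x \<in> range (\<lambda>n::int. a [^]\<^bsub>mult_of R\<^esub> n)" by blast
    qed
    show "range (\<lambda>n::int. a [^]\<^bsub>mult_of R\<^esub> n) \<subseteq> carrier (mult_of R)"
      using M.int_pow_closed[OF a(1)] by blast
  qed
  then show ?thesis using a(1) M.cyclic_group by blast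
qed

context invariant_spread
begin

lemma qmulap_comp:
  assumes L: "L \<in> \<L>" and w: "w \<noteq> 0"
  shows "compose L (qmulap L z) (qmulap L w) =
    qmulap L (fst z * fst w + m * snd z * snd w, fst z * snd w + snd z * fst w)"
proof (rule qmulap_eqI[OF L])
  fix v assume v: "v \<in> affine_cone L" "v \<noteq> 0"
  then have "vec.span {v} \<in> L" using span_in_line_iff L by blast
  moreover have "qmul w v \<noteq> 0" using w v by (simp add: qmul_eq_0_iff)
  ultimately show "compose L (qmulap L z) (qmulap L w) (vec.span {v}) =
    vec.span {qmul (fst z * fst w + m * snd z * snd w, fst z * snd w + snd z * fst w) v}"
    using v by (simp add: compose_def qmulap_span L qmul_in_cone qmul_qmul)
qed simp

text \<open>Normalizing the second coordinate of the multiplier, the points are those of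
  \<open>(a, 1) v\<close> for \<open>a\<close> in \<open>K\<close>, and the point of
  \<open>v\<close> itself.\<close>

lemma card_line:
  assumes "L \<in> \<L>" and fin: "finite (UNIV :: 'k set)"
  shows "card L = CARD('k) + 1"
proof -
  obtain v where v: "v \<in> affine_cone L" "v \<noteq> 0" using nonzero_in_line[OF assms(1)] .
  let ?p = "\<lambda>a. vec.span {qmul (a, 1) v}"
  have nz: "qmul (a, 1) v \<noteq> 0" for a using v by (simp add: qmul_eq_0_iff zero_prod_def)
  have "L = insert (vec.span {v}) (range ?p)"
  proof
    show "insert (vec.span {v}) (range ?p) \<subseteq> L"
      using v nz span_in_line_iff qmul_in_cone assms(1) by auto
    show "L \<subseteq> insert (vec.span {v}) (range ?p)"
    proof
      fix p assume "p \<in> L"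
      then obtain u where u: "u \<noteq> 0" "u \<in> affine_cone L" "p = vec.span {u}"
        using lineE assms(1) by blast
      obtain z where z: "u = qmul z v" using u(2) cone_eq_qline[OF assms(1) v] by (auto simp: qline_def)
      show "p \<in> insert (vec.span {v}) (range ?p)"
      proof (cases "snd z = 0")
        case True
        then have "u = fst z *s v" "fst z \<noteq> 0" using z u(1) by (auto simp: qmul_def)
        then show ?thesis using u(3) by (simp add: span_singleton_scale)
      next
        case False
        then have "u = snd z *s qmul (fst z / snd z, 1) v" using z by (simp add: qmul_scale)
        then have "p = ?p (fst z / snd z)" using u(3) span_singleton_scale[OF False] by simp
        then show ?thesis by blast
      qed
    qed
  qed
  moreover have "inj ?p"
  proof (rule injI)
    fix a b assume "?p a = ?p b"
    then obtain c where "qmul (a, 1) v = c *s qmul (b, 1) v"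
      using span_singleton_eq_iff[OF nz] by blast
    then show "a = b" using qmul_inject[OF v(2)] by (simp add: qmul_scale)
  qed
  moreover have "vec.span {v} \<notin> range ?p"
  proof
    assume "vec.span {v} \<in> range ?p"
    then obtain a where "vec.span {v} = ?p a" by (rule rangeE)
    then obtain c where c: "c \<noteq> 0" "v = c *s qmul (a, 1) v"
      unfolding span_singleton_eq_iff[OF v(2)] by (elim exE conjE)
    then have "qmul (1, 0) v = qmul (c * a, c) v" unfolding qmul_scale by simp
    then show False using qmul_inject[OF v(2), of "(1, 0)"] c(1) by simp
  qed
  ultimately have "card L = card (insert (vec.span {v}) (range ?p))" "finite (range ?p)"
    "card (range ?p) = CARD('k)" "vec.span {v} \<notin> range ?p"
    using fin by (simp_all only: card_image finite_imageI not_False_eq_True)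
  then show ?thesis by (simp only: card_insert_disjoint Suc_eq_plus1 not_False_eq_True)
qed

text \<open>The map from \<open>z\<close> to multiplication by \<open>z\<close> is an epimorphism
  from the cyclic group of units of \<open>K[\<Theta>]\<close>.\<close>

lemma groupoid_group_cyclic:
  assumes L: "L \<in> \<L>" and fin: "finite (UNIV :: 'k set)" and group: "group (groupoid_group \<L> L)"
  shows "cyclic_group (groupoid_group \<L> L)"
proof -
  interpret R: field "quadratic_ring m" by (rule field_quadratic_ring[OF nonsquare])
  have car: "carrier (mult_of (quadratic_ring m)) = - {0}"
    by (auto simp: quadratic_ring_def)
  have "finite (carrier (quadratic_ring m))"
    using fin by (simp add: quadratic_ring_def finite_prod)
  then have cyc: "cyclic_group (mult_of (quadratic_ring m))" by (rule R.cyclic_group_mult_of)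
  have "qmulap L \<in> hom (mult_of (quadratic_ring m)) (groupoid_group \<L> L)"
  proof (rule homI)
    fix z w assume zw: "z \<in> carrier (mult_of (quadratic_ring m))" "w \<in> carrier (mult_of (quadratic_ring m))"
    show "qmulap L z \<in> carrier (groupoid_group \<L> L)"
      using zw qmulap_arrow[OF L] by (simp add: car groupoid_group_def del: carrier_mult_of)
    show "qmulap L (z \<otimes>\<^bsub>mult_of (quadratic_ring m)\<^esub> w) = qmulap L z \<otimes>\<^bsub>groupoid_group \<L> L\<^esub> qmulap L w"
      using zw qmulap_comp[OF L, of w z] unfolding car by (simp add: groupoid_group_def quadratic_ring_def)
  qed
  moreover have "qmulap L ` carrier (mult_of (quadratic_ring m)) = carrier (groupoid_group \<L> L)"
    unfolding car by (auto simp: groupoid_group_def arrow_loop_iff[OF L])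
  ultimately show ?thesis
    using group.cyclic_group_epimorphic_image[OF R.field_mult_group _ cyc group] by (auto simp: epi_def)
qed

text \<open>The loops act simply transitively on the points of \<open>L\<close>, so evaluation at
  one point is a bijection onto \<open>L\<close>.\<close>

lemma order_groupoid_group:
  assumes L: "L \<in> \<L>" and fin: "finite (UNIV :: 'k set)"
  shows "Coset.order (groupoid_group \<L> L) = CARD('k) + 1"
proof -
  obtain v where v: "v \<in> affine_cone L" "v \<noteq> 0" using nonzero_in_line[OF L] .
  have bij: "bij_betw (\<lambda>f. f (vec.span {v})) (carrier (groupoid_group \<L> L)) L"
  proof (rule bij_betwI')
    fix f g assume "f \<in> carrier (groupoid_group \<L> L)" "g \<in> carrier (groupoid_group \<L> L)"
    then obtain z w where zw: "z \<noteq> 0" "f = qmulap L z" "w \<noteq> 0" "g = qmulap L w"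
      by (auto simp: groupoid_group_def arrow_loop_iff[OF L])
    show "f (vec.span {v}) = g (vec.span {v}) \<longleftrightarrow> f = g"
    proof
      assume "f (vec.span {v}) = g (vec.span {v})"
      then have "vec.span {qmul z v} = vec.span {qmul w v}" using zw qmulap_span[OF L v] by simp
      then obtain c where c: "c \<noteq> 0" "qmul z v = c *s qmul w v"
        using span_singleton_eq_iff zw v qmul_eq_0_iff by metis
      \<comment> \<open>Loops that agree at one point have multipliers differing by a factor in
        \<open>K\<close>, hence agree at all points.\<close>
      then have "z = (c * fst w, c * snd w)" using qmul_inject[OF v(2)] by (simp add: qmul_scale)
      then have "qmul z u = c *s qmul w u" for u by (simp add: qmul_scale)
      then have "vec.span {qmul z u} = vec.span {qmul w u}" for u
        using span_singleton_scale[OF c(1)] by simp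
      then have "qmulap L z = qmulap L w"
        by (intro qmulap_eqI L) (auto simp: qmulap_span L, simp add: qmulap_def)
      then show "f = g" using zw by simp
    qed simp
  next
    fix f assume "f \<in> carrier (groupoid_group \<L> L)"
    then obtain z where z: "z \<noteq> 0" "f = qmulap L z"
      by (auto simp: groupoid_group_def arrow_loop_iff[OF L])
    then show "f (vec.span {v}) \<in> L"
      using qmulap_span[OF L v] span_in_line_iff[OF L] qmul_in_cone[OF L v(1)] v by (simp add: qmul_eq_0_iff)
  next
    fix p assume "p \<in> L"
    then obtain u where u: "u \<noteq> 0" "u \<in> affine_cone L" "p = vec.span {u}"
      using lineE L by blast
    obtain z where z: "u = qmul z v" using u(2) cone_eq_qline[OF L v] by (auto simp: qline_def)
    then have "z \<noteq> 0" using u(1) by (auto simp: qmul_eq_0_iff)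
    then have "qmulap L z \<in> carrier (groupoid_group \<L> L)"
      using qmulap_arrow[OF L] by (simp add: groupoid_group_def)
    then show "\<exists>f\<in>carrier (groupoid_group \<L> L). p = f (vec.span {v})"
      using z u(3) qmulap_span[OF L v] by metis
  qed
  show ?thesis
    using card_line[OF L fin] bij_betw_same_card[OF bij] by (simp add: Coset.order_def)
qed

end

section \<open>The Hopf spread\<close>

text \<open>Replacing \<Theta> by a multiple changes \<open>m\<close> by a square factor, which
  allows \<open>m\<close> to be matched with the square of \<alpha>.\<close>

lemma (in quadratic_structure) quadratic_structure_scale:
  assumes "c \<noteq> 0"
  shows "quadratic_structure (\<lambda>v. c *s \<Theta> v) (c * c * m)"
proof
  fix d
  show "c *s \<Theta> (c *s \<Theta> v) = (c * c * m) *s v" for v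
    by (simp add: lin_simps(2)[OF lin_\<Theta>] \<Theta>_\<Theta> vector_smult_assoc mult_ac)
  show "d * d \<noteq> c * c * m"
  proof
    assume "d * d = c * c * m"
    then have "(d / c) * (d / c) = m" using assms by (simp add: field_simps)
    then show False using nonsquare by blast
  qed
qed (auto simp: lin_simps(1,2)[OF lin_\<Theta>] vec_eq_iff algebra_simps)

text \<open>Squaring is at most two-to-one, so at least half of the nonzero elements are squares.
  Their multiples by \<open>m\<close> form a disjoint set of equal size, and the two sets exhaust
  the nonzero elements.\<close>

lemma nonsquare_quotient_square:
  fixes m n :: "'k::{field,finite}"
  assumes m: "\<And>c. c * c \<noteq> m" and n: "\<And>c. c * c \<noteq> n"
  obtains c where "c \<noteq> 0" "n = c * c * m"
proof -
  let ?K = "- {0} :: 'k set" and ?sq = "\<lambda>c :: 'k. c * c"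
  let ?Q = "?sq ` ?K" and ?mQ = "(\<lambda>c. m * c) ` ?sq ` ?K"
  have m0: "m \<noteq> 0" using m[of 0] by auto
  have fiber: "card {c \<in> ?K. ?sq c = s} \<le> 2" if s: "s \<in> ?Q" for s
  proof -
    obtain d where d: "s = d * d" using s by blast
    then have "{c \<in> ?K. ?sq c = s} \<subseteq> {d, - d}" by (auto simp: square_eq_iff)
    then have "card {c \<in> ?K. ?sq c = s} \<le> card {d, - d}" by (intro card_mono) auto
    also have "\<dots> \<le> 2" by (simp add: card_insert_if)
    finally show ?thesis .
  qed
  have "?K = (\<Union>s\<in>?Q. {c \<in> ?K. ?sq c = s})" by blast
  then have "card ?K \<le> (\<Sum>s\<in>?Q. card {c \<in> ?K. ?sq c = s})"
    using card_UN_le[of ?Q "\<lambda>s. {c \<in> ?K. ?sq c = s}"] by (metis finite)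
  also have "\<dots> \<le> (\<Sum>s\<in>?Q. 2)" by (rule sum_mono) (rule fiber)
  finally have le: "card ?K \<le> card ?Q + card ?Q" by simp
  have "card ?mQ = card ?Q"
    by (rule card_image) (use m0 in \<open>auto intro: inj_onI\<close>)
  moreover have "?Q \<inter> ?mQ = {}"
  proof (rule ccontr)
    assume "?Q \<inter> ?mQ \<noteq> {}"
    then obtain c d where cd: "c * c = m * (d * d)" "d \<noteq> 0" by auto
    then have "(c / d) * (c / d) = m" by (simp add: field_simps)
    then show False using m by blast
  qed
  ultimately have "card (?Q \<union> ?mQ) = card ?Q + card ?Q" by (simp add: card_Un_disjoint)
  then have "?Q \<union> ?mQ = ?K"
    using le by (intro card_seteq) (use m0 in auto)
  moreover have "n \<in> ?K" "n \<notin> ?Q" using n[of 0] n by auto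
  ultimately have "n \<in> ?mQ" by blast
  then obtain c where "c \<noteq> 0" "n = m * (c * c)" by blast
  then show ?thesis using that[of c] by (simp add: mult_ac)
qed

text \<open>Multiplication by \<alpha> on \<open>J^2\<close>, where \<alpha> squares to
  \<open>m\<close>, in the coordinates \<open>(a, b, c, d)\<close> of the vector
  \<open>(a + \<alpha> b, c + \<alpha> d)\<close>.\<close>

definition standard_structure :: "'k::field \<Rightarrow> 'k ^ 4 \<Rightarrow> 'k ^ 4" where
  "standard_structure m v = (\<chi> i. if i = 1 then m * v$2 else if i = 2 then v$1
    else if i = 3 then m * v$4 else v$3)"

lemma standard_structure_nth [simp]:
  "standard_structure m v $ 1 = m * v$2" "standard_structure m v $ 2 = v$1"
  "standard_structure m v $ 3 = m * v$4" "standard_structure m v $ 4 = v$3"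
  by (simp_all add: standard_structure_def)

lemma quadratic_structure_std:
  assumes "\<And>c. c * c \<noteq> m"
  shows "quadratic_structure (standard_structure m) m"
proof
  show "standard_structure m (standard_structure m v) = m *s v" for v by (simp add: vec_eq_iff forall_4)
qed (use assms in \<open>auto simp: vec_eq_iff forall_4 algebra_simps\<close>)

section \<open>The Hopf map in coordinates\<close>

locale hopf_extension =
  fixes \<iota> :: "'k::field \<Rightarrow> 'j::field" and \<alpha> :: 'j
  assumes ext: "quadratic_extension \<iota> \<alpha>"
begin

lemma \<iota>_1 [simp]: "\<iota> 1 = 1" and \<iota>_add: "\<iota> (x + y) = \<iota> x + \<iota> y" and \<iota>_mult: "\<iota> (x * y) = \<iota> x * \<iota> y"
  using ext by (auto simp: quadratic_extension_def field_embedding_def)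

lemma \<iota>_0 [simp]: "\<iota> 0 = 0"
  using \<iota>_add[of 0 0] by (metis add.right_neutral add_left_cancel)

lemma \<iota>_minus: "\<iota> (- x) = - \<iota> x"
  using \<iota>_add[of x "- x"] by (simp add: eq_neg_iff_add_eq_0 add.commute)

lemma \<iota>_eq_0_iff [simp]: "\<iota> x = 0 \<longleftrightarrow> x = 0"
proof
  assume "\<iota> x = 0"
  then have "\<iota> (x * inverse x) = 0" by (simp add: \<iota>_mult)
  then show "x = 0" by (cases "x = 0") simp_all
qed simp

definition m :: 'k where
  "m = (SOME c. \<iota> c = \<alpha>\<^sup>2)"

lemma \<iota>_m: "\<iota> m = \<alpha> * \<alpha>"
proof -
  have "\<exists>c. \<iota> c = \<alpha>\<^sup>2" using ext by (auto simp: quadratic_extension_def)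
  then have "\<iota> m = \<alpha>\<^sup>2" unfolding m_def by (rule someI_ex)
  then show ?thesis by (simp add: power2_eq_square)
qed

text \<open>Induction on the polynomial: in each Horner step the square of \<alpha> is replaced by
  \<open>m\<close>.\<close>

lemma \<iota>_\<alpha>_span: 
  obtains a b where "x = \<iota> a + \<alpha> * \<iota> b"
proof -
  have poly: "\<exists>a b. poly (map_poly \<iota> p) \<alpha> = \<iota> a + \<alpha> * \<iota> b" for p
  proof (induction p)
    case 0
    show ?case by (intro exI[of _ 0]) simp
  next
    case (pCons c p)
    then obtain a b where ab: "poly (map_poly \<iota> p) \<alpha> = \<iota> a + \<alpha> * \<iota> b" by blast
    have "poly (map_poly \<iota> (pCons c p)) \<alpha> = \<iota> (c + m * b) + \<alpha> * \<iota> a"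
      using pCons(1) by (simp add: map_poly_pCons ab \<iota>_add \<iota>_mult \<iota>_m algebra_simps)
    then show ?case by blast
  qed
  obtain p where "x = poly (map_poly \<iota> p) \<alpha>" using ext by (auto simp: quadratic_extension_def)
  then show ?thesis using poly[of p] that by auto
qed

text \<open>Otherwise 1 alone would span \<open>J\<close> over \<open>K\<close>, against dimension
  2.\<close>

lemma \<alpha>_notin_range: "\<alpha> \<noteq> \<iota> c"
proof
  assume c: "\<alpha> = \<iota> c"
  interpret J: vector_space "\<lambda>c x. \<iota> c * x"
    by unfold_locales (simp_all add: \<iota>_add \<iota>_mult algebra_simps)
  have "x \<in> J.span {1}" for x
  proof -
    obtain a b where "x = \<iota> a + \<alpha> * \<iota> b" by (rule \<iota>_\<alpha>_span)
    then have "x = \<iota> (a + c * b) * 1" by (simp add: c \<iota>_add \<iota>_mult)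
    then show ?thesis using J.span_scale[OF J.span_base[of 1 "{1}"]] by auto
  qed
  then have "J.dim UNIV \<le> card {1::'j}" by (intro J.dim_le_card) auto
  then show False using ext by (simp add: quadratic_extension_def)
qed

lemma nonsquare: "c * c \<noteq> m"
proof
  assume "c * c = m"
  then have "\<alpha> * \<alpha> = \<iota> c * \<iota> c" using \<iota>_m \<iota>_mult by metis
  then have "\<alpha> = \<iota> c \<or> \<alpha> = \<iota> (- c)" by (simp add: square_eq_iff \<iota>_minus)
  then show False using \<alpha>_notin_range by blast
qed

lemma \<iota>_\<alpha>_eq_0: "\<iota> a + \<alpha> * \<iota> b = 0 \<longleftrightarrow> a = 0 \<and> b = 0"
proof
  assume 0: "\<iota> a + \<alpha> * \<iota> b = 0"
  have "b = 0"
  proof (rule ccontr)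
    assume b: "b \<noteq> 0"
    have "\<alpha> = \<alpha> * \<iota> (b * inverse b)" using b by simp
    also have "\<dots> = (\<alpha> * \<iota> b) * \<iota> (inverse b)" by (simp add: \<iota>_mult)
    also have "\<alpha> * \<iota> b = - \<iota> a" using 0 by (simp add: add_eq_0_iff)
    finally have "\<alpha> = \<iota> (- a * inverse b)" by (simp add: \<iota>_mult \<iota>_minus)
    then show False using \<alpha>_notin_range by blast
  qed
  then show "a = 0 \<and> b = 0" using 0 by simp
qed simp

sublocale std: quadratic_structure "standard_structure m" m
  by (rule quadratic_structure_std) (rule nonsquare)

lemma hopf_vec_nth [simp]:
  "hopf_vec \<iota> \<alpha> v $ 1 = \<iota> (v$1) + \<alpha> * \<iota> (v$2)"
  "hopf_vec \<iota> \<alpha> v $ 2 = \<iota> (v$3) + \<alpha> * \<iota> (v$4)"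
  by (simp_all add: hopf_vec_def)

text \<open>The Hopf map turns the action of pairs into scalar multiplication on \<open>J^2\<close>,
  so \<open>J\<close>-lines pull back to \<open>std.qline\<close>.\<close>

lemma hopf_vec_qmul: "hopf_vec \<iota> \<alpha> (std.qmul z v) = (\<iota> (fst z) + \<alpha> * \<iota> (snd z)) *s hopf_vec \<iota> \<alpha> v"
  by (simp add: vec_eq_iff forall_2 std.qmul_def \<iota>_add \<iota>_mult \<iota>_m algebra_simps)

lemma hopf_vec_scale: "hopf_vec \<iota> \<alpha> (c *s v) = \<iota> c *s hopf_vec \<iota> \<alpha> v"
  by (simp add: vec_eq_iff forall_2 \<iota>_mult algebra_simps)

lemma hopf_vec_inject: "hopf_vec \<iota> \<alpha> u = hopf_vec \<iota> \<alpha> v \<longleftrightarrow> u = v"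
proof
  assume "hopf_vec \<iota> \<alpha> u = hopf_vec \<iota> \<alpha> v"
  then have "\<iota> (u$1 + - v$1) + \<alpha> * \<iota> (u$2 + - v$2) = 0"
    "\<iota> (u$3 + - v$3) + \<alpha> * \<iota> (u$4 + - v$4) = 0"
    by (simp_all only: \<iota>_add \<iota>_minus) (simp_all add: vec_eq_iff forall_2 algebra_simps)
  then show "u = v" unfolding \<iota>_\<alpha>_eq_0 by (simp add: vec_eq_iff forall_4)
qed simp

lemma hopf_vec_0 [simp]: "hopf_vec \<iota> \<alpha> 0 = 0"
  by (simp add: vec_eq_iff forall_2)

lemma hopf_vec_surj:
  obtains u where "hopf_vec \<iota> \<alpha> u = q"
proof -
  obtain a b where 1: "q$1 = \<iota> a + \<alpha> * \<iota> b" by (rule \<iota>_\<alpha>_span)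
  obtain c d where 2: "q$2 = \<iota> c + \<alpha> * \<iota> d" by (rule \<iota>_\<alpha>_span)
  let ?u = "(\<chi> i. if i = 1 then a else if i = 2 then b else if i = 3 then c else d) :: 'k ^ 4"
  have "hopf_vec \<iota> \<alpha> ?u = q" by (simp add: vec_eq_iff forall_2 1 2)
  then show ?thesis by (rule that)
qed

lemma hopf_map_span: "hopf_map \<iota> \<alpha> (vec.span {u}) = vec.span {hopf_vec \<iota> \<alpha> u}"
proof
  show "hopf_map \<iota> \<alpha> (vec.span {u}) \<subseteq> vec.span {hopf_vec \<iota> \<alpha> u}"
    unfolding hopf_map_def
    by (rule vec.span_minimal[OF _ vec.subspace_span]) (auto simp: vec.span_singleton hopf_vec_scale)
  have "hopf_vec \<iota> \<alpha> u \<in> hopf_vec \<iota> \<alpha> ` vec.span {u}" by (simp add: vec.span_base)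
  then show "vec.span {hopf_vec \<iota> \<alpha> u} \<subseteq> hopf_map \<iota> \<alpha> (vec.span {u})"
    unfolding hopf_map_def by (intro vec.span_mono) simp
qed

lemma hopf_fiber:
  assumes "u \<noteq> 0"
  shows "{P \<in> proj_points. hopf_map \<iota> \<alpha> P = vec.span {hopf_vec \<iota> \<alpha> u}} = proj_flat (std.qline u)"
proof -
  have iff: "hopf_map \<iota> \<alpha> (vec.span {v}) = vec.span {hopf_vec \<iota> \<alpha> u} \<longleftrightarrow> v \<in> std.qline u"
    if "v \<noteq> 0" for v
  proof -
    have nz: "hopf_vec \<iota> \<alpha> v \<noteq> 0" using that hopf_vec_inject[of v 0] by simp
    have "hopf_map \<iota> \<alpha> (vec.span {v}) = vec.span {hopf_vec \<iota> \<alpha> u} \<longleftrightarrow>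
        (\<exists>c. hopf_vec \<iota> \<alpha> v = c *s hopf_vec \<iota> \<alpha> u)"
      using nz by (auto simp: hopf_map_span span_singleton_eq_iff)
    \<comment> \<open>Every scalar of \<open>J\<close> is given by a pair over
      \<open>K\<close>.\<close>
    also have "\<dots> \<longleftrightarrow> (\<exists>z. hopf_vec \<iota> \<alpha> v = (\<iota> (fst z) + \<alpha> * \<iota> (snd z)) *s hopf_vec \<iota> \<alpha> u)"
      using \<iota>_\<alpha>_span by (metis fst_conv snd_conv)
    also have "\<dots> \<longleftrightarrow> v \<in> std.qline u"
      unfolding hopf_vec_qmul[symmetric] hopf_vec_inject by (auto simp: std.qline_def)
    finally show ?thesis .
  qed
  show ?thesis
  proof (rule Set.set_eqI)
    fix P :: "('k ^ 4) set"
    show "P \<in> {P \<in> proj_points. hopf_map \<iota> \<alpha> P = vec.span {hopf_vec \<iota> \<alpha> u}} \<longleftrightarrow>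
      P \<in> proj_flat (std.qline u)"
    proof (cases "P \<in> proj_points")
      case True
      then obtain v where "v \<noteq> 0" "P = vec.span {v}" unfolding proj_points_iff by blast
      then show ?thesis using True iff span_in_proj_flat_iff[OF std.subspace_qline] by simp
    qed (simp add: proj_flat_def)
  qed
qed

lemma hopf_fibers_eq: "hopf_fibers \<iota> \<alpha> = {proj_flat (std.qline u) |u. u \<noteq> 0}"
proof -
  have pts: "Q \<in> proj_points \<longleftrightarrow> (\<exists>u. u \<noteq> 0 \<and> Q = vec.span {hopf_vec \<iota> \<alpha> u})" for Q
  proof
    assume "Q \<in> proj_points"
    then obtain q where q: "q \<noteq> 0" "Q = vec.span {q}" unfolding proj_points_iff by blast
    obtain u where "hopf_vec \<iota> \<alpha> u = q" by (rule hopf_vec_surj)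
    with q show "\<exists>u. u \<noteq> 0 \<and> Q = vec.span {hopf_vec \<iota> \<alpha> u}" by (intro exI[of _ u]) auto
  next
    assume "\<exists>u. u \<noteq> 0 \<and> Q = vec.span {hopf_vec \<iota> \<alpha> u}"
    then show "Q \<in> proj_points"
      using hopf_vec_inject[of _ 0] unfolding proj_points_iff hopf_vec_0 by blast
  qed
  have "hopf_fibers \<iota> \<alpha> =
      {{P \<in> proj_points. hopf_map \<iota> \<alpha> P = vec.span {hopf_vec \<iota> \<alpha> u}} |u. u \<noteq> 0}"
    unfolding hopf_fibers_def by (rule Set.set_eqI) (unfold mem_Collect_eq pts, blast)
  also have "\<dots> = {proj_flat (std.qline u) |u. u \<noteq> 0}"
    by (simp add: hopf_fiber cong: rev_conj_cong)
  finally show ?thesis .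
qed

end

lemma proj_action_proj_flat:
  fixes A :: "'k::field ^ 4 ^ 4"
  assumes "invertible A"
  shows "proj_action A ` proj_flat W = proj_flat ((*v) A ` W)"
proof -
  obtain A' where A': "A' ** A = mat 1" using assms by (auto simp: invertible_def)
  have inv: "A' *v (A *v x) = x" for x using A' by (simp add: matrix_vector_mul_assoc)
  have nz: "A *v x \<noteq> 0" if "x \<noteq> 0" for x using inv[of x] that by (metis matrix_vector_mult_0_right)
  have span: "(*v) A ` vec.span {x} = vec.span {A *v x}" for x
    using vec.linear_span_image[OF matrix_vector_mul_linear_gen, of A "{x}"] by simp
  show ?thesis
  proof
    show "proj_action A ` proj_flat W \<subseteq> proj_flat ((*v) A ` W)"
    proof
      fix Q assume "Q \<in> proj_action A ` proj_flat W"
      then obtain x where "x \<noteq> 0" "vec.span {x} \<subseteq> W" "Q = (*v) A ` vec.span {x}"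
        by (auto simp: proj_action_def proj_flat_def proj_points_iff)
      then show "Q \<in> proj_flat ((*v) A ` W)"
        unfolding proj_flat_def proj_points_iff using nz span by blast
    qed
    show "proj_flat ((*v) A ` W) \<subseteq> proj_action A ` proj_flat W"
    proof
      fix Q assume "Q \<in> proj_flat ((*v) A ` W)"
      then obtain y where y: "y \<noteq> 0" "vec.span {y} \<subseteq> (*v) A ` W" "Q = vec.span {y}"
        by (auto simp: proj_flat_def proj_points_iff)
      then obtain x where x: "y = A *v x" using vec.span_base[of y "{y}"] by blast
      have "vec.span {x} \<subseteq> W"
      proof
        fix u assume "u \<in> vec.span {x}"
        then have "A *v u \<in> (*v) A ` W" using y(2) x span by blast
        then show "u \<in> W" using inv by (metis imageE)
      qed
      moreover have "x \<noteq> 0" using x y(1) by auto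
      ultimately have "vec.span {x} \<in> proj_flat W" unfolding proj_flat_def proj_points_iff by blast
      then show "Q \<in> proj_action A ` proj_flat W"
        using y(3) x span by (auto simp: proj_action_def)
    qed
  qed
qed

section \<open>Change of basis to the Hopf spread\<close>

context invariant_spread
begin

text \<open>The line of the spread through \<open>v\<close> must be the
  \<open>K[\<Theta>]\<close>-line of \<open>v\<close>, and fullness makes all of these
  occur.\<close>

lemma spread_eq_qlines: "\<L> = {proj_flat (qline v) |v. v \<noteq> 0}"
proof (intro equalityI subsetI)
  fix L assume L: "L \<in> \<L>"
  obtain v where v: "v \<in> affine_cone L" "v \<noteq> 0" using nonzero_in_line[OF L] .
  then show "L \<in> {proj_flat (qline v) |v. v \<noteq> 0}" using line(3)[OF L] cone_eq_qline[OF L v] by auto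
next
  fix L assume "L \<in> {proj_flat (qline v) |v. v \<noteq> 0}"
  then obtain v where v: "v \<noteq> 0" "L = proj_flat (qline v)" by blast
  obtain M where M: "M \<in> \<L>" "v \<in> affine_cone M" using cover .
  then show "L \<in> \<L>" using v line(3)[OF M(1)] cone_eq_qline[OF M v(1)] by simp
qed

lemma conjugate_to_std:
  obtains A :: "'k ^ 4 ^ 4" where "invertible A" "\<And>v. A *v \<Theta> v = standard_structure m (A *v v)"
proof -
  obtain L where L: "L \<in> \<L>" using cover .
  obtain M where M: "M \<in> \<L>" "L \<noteq> M" using two_more_lines[OF L] by metis
  obtain v where v: "v \<in> affine_cone L" "v \<noteq> 0" using nonzero_in_line[OF L] .
  obtain w where w: "w \<in> affine_cone M" "w \<noteq> 0" using nonzero_in_line[OF M(1)] .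
  \<comment> \<open>Vectors \<open>v\<close>, \<open>w\<close> from two skew lines form a basis over
    \<open>K[\<Theta>]\<close>; \<open>f\<close> is the resulting coordinate map and
    \<open>A\<close> below inverts its matrix.\<close>
  define f where "f x = qmul (x$1, x$2) v + qmul (x$3, x$4) w" for x :: "'k ^ 4"
  have lf: "lin f"
    by (rule linI) (auto simp: f_def qmul_def vec_eq_iff algebra_simps)
  have f\<Theta>: "f (standard_structure m x) = \<Theta> (f x)" for x
    unfolding f_def qmul_def lin_simps(1,2)[OF lin_\<Theta>] \<Theta>_\<Theta> by (simp add: vec_eq_iff algebra_simps)
  have "x = 0" if "f x = 0" for x
  proof -
    have "qmul (x$1, x$2) v = qmul (- x$3, - x$4) w"
      using that by (simp add: f_def qmul_def vec_eq_iff algebra_simps eq_neg_iff_add_eq_0)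
    then have "qmul (x$1, x$2) v = 0"
      using meet[OF L M] qmul_in_cone[OF L v(1)] qmul_in_cone[OF M(1) w(1)] by metis
    moreover from this that have "qmul (x$3, x$4) w = 0" by (simp add: f_def)
    ultimately have "x$1 = 0 \<and> x$2 = 0" "x$3 = 0 \<and> x$4 = 0"
      using v(2) w(2) by (simp_all add: qmul_eq_0_iff zero_prod_def)
    then show ?thesis by (simp add: vec_eq_iff forall_4)
  qed
  then have "inj f" using vec.linear_inj_iff_eq_0[OF lf] by blast
  define C where "C = matrix f"
  have C: "C *v x = f x" for x unfolding C_def by (rule matrix_works[OF lf])
  then have "inj ((*v) C)" using \<open>inj f\<close> by (simp add: inj_def)
  then obtain A where A: "A ** C = mat 1" using matrix_left_invertible_injective[of C] by blast
  then have A': "C ** A = mat 1" using matrix_left_right_inverse by blast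
  have AC: "A *v (C *v x) = x" "C *v (A *v x) = x" for x
    using A A' by (simp_all add: matrix_vector_mul_assoc)
  have "A *v \<Theta> u = standard_structure m (A *v u)" for u
  proof -
    have "C *v standard_structure m (A *v u) = \<Theta> u" using f\<Theta>[of "A *v u"] AC(2)[of u] unfolding C by simp
    then show ?thesis using AC(1)[of "standard_structure m (A *v u)"] by simp
  qed
  moreover have "invertible A" using A A' unfolding invertible_def by blast
  ultimately show ?thesis using that by blast
qed

lemma projectively_equivalent_hopf:
  assumes "hopf_extension \<iota> \<alpha>" and m: "hopf_extension.m \<iota> \<alpha> = m"
  shows "projectively_equivalent \<L> (hopf_fibers \<iota> \<alpha>)"
proof -
  interpret hopf_extension \<iota> \<alpha> by fact
  obtain A :: "'k ^ 4 ^ 4" where A: "invertible A" "\<And>v. A *v \<Theta> v = standard_structure m (A *v v)"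
    using conjugate_to_std by blast
  obtain A' where A': "A' ** A = mat 1" "A ** A' = mat 1" using A(1) by (auto simp: invertible_def)
  have inv: "A *v (A' *v x) = x" "A' *v (A *v x) = x" for x
    using A' by (simp_all add: matrix_vector_mul_assoc)
  \<comment> \<open>As \<open>A\<close> intertwines the two operators, it carries lines over the one
    to lines over the other; this uses the same \<open>m\<close> for both.\<close>
  have "(*v) A ` qline v = std.qline (A *v v)" for v
    unfolding qline_def std.qline_def image_image qmul_def std.qmul_def
    by (simp add: vec.add vec.scale A(2) m)
  then have img: "proj_action A ` proj_flat (qline v) = proj_flat (std.qline (A *v v))" for v
    using proj_action_proj_flat[OF A(1)] by simp
  have nz: "A *v v \<noteq> 0" "A' *v v \<noteq> 0" if "v \<noteq> 0" for v
    using inv that by (metis matrix_vector_mult_0_right)+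
  have "(\<lambda>L. proj_action A ` L) ` \<L> = (\<lambda>L. proj_action A ` L) ` {proj_flat (qline v) |v. v \<noteq> 0}"
    using spread_eq_qlines by (rule arg_cong)
  also have "\<dots> = {proj_action A ` proj_flat (qline v) |v. v \<noteq> 0}" by blast
  also have "\<dots> = {proj_flat (std.qline (A *v v)) |v. v \<noteq> 0}" unfolding img ..
  also have "\<dots> = hopf_fibers \<iota> \<alpha>"
    unfolding hopf_fibers_eq
  proof (intro equalityI subsetI)
    fix M assume "M \<in> {proj_flat (std.qline u) |u. u \<noteq> 0}"
    then obtain u where u: "u \<noteq> 0" "M = proj_flat (std.qline u)" by blast
    then have "M = proj_flat (std.qline (A *v (A' *v u)))" by (simp only: inv)
    then show "M \<in> {proj_flat (std.qline (A *v v)) |v. v \<noteq> 0}" using nz(2)[OF u(1)] by blast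
  qed (use nz(1) in blast)
  finally have "(\<lambda>L. proj_action A ` L) ` \<L> = hopf_fibers \<iota> \<alpha>" .
  then show ?thesis unfolding projectively_equivalent_def using A(1) by blast
qed

end

theorem theorem2p2p1:
  fixes \<L> :: "('k::{field,finite} ^ 4) set set set"
    and L :: "('k ^ 4) set set"
    and \<iota> :: "'k \<Rightarrow> 'j::field"
    and \<alpha> :: 'j
  assumes "CHAR('k) > 2"
    and "full_spread \<L>"
    and "L \<in> \<L>"
    and "comm_group (groupoid_group \<L> L)"
  shows "(quadratic_extension \<iota> \<alpha> \<longrightarrow>
            projectively_equivalent \<L> (hopf_fibers \<iota> \<alpha>)) \<and>
         cyclic_group (groupoid_group \<L> L) \<and>
         Coset.order (groupoid_group \<L> L) = CARD('k) + 1"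
proof -
  interpret spread4 \<L> by unfold_locales fact
  have two: "(2::'k) \<noteq> 0"
  proof
    assume "(2::'k) = 0"
    then have "of_nat 2 = (0::'k)" by simp
    then have "CHAR('k) dvd 2" by (simp only: of_nat_eq_0_iff_char_dvd)
    then show False using assms(1) by (auto dest: dvd_imp_le)
  qed
  interpret G: comm_group "groupoid_group \<L> L" by fact
  obtain B C E F where fr: "frame4 \<L> L B C E F" using frame_exists[OF assms(3)] .
  interpret frame4 \<L> L B C E F by fact
  interpret abelian_frame4 \<L> L B C E F
  proof
    fix f g assume "arrow \<L> L L f" "arrow \<L> L L g"
    then show "compose L f g = compose L g f"
      using G.m_comm[of f g] by (simp add: groupoid_group_def)
  qed
  obtain \<Theta> m where \<Theta>: "lin \<Theta>" "\<And>v. \<Theta> (\<Theta> v) = m *s v" "\<And>c. c * c \<noteq> m"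
    "\<And>V v. \<lbrakk>V \<in> \<L>; v \<in> affine_cone V\<rbrakk> \<Longrightarrow> \<Theta> v \<in> affine_cone V"
    using quadratic_structure_exists[OF two] by blast
  interpret J: quadratic_structure \<Theta> m by (rule quadratic_structure.intro) (fact \<Theta>)+
  interpret invariant_spread \<L> \<Theta> m
    by (intro invariant_spread.intro spread4_axioms J.quadratic_structure_axioms invariant_spread_axioms.intro) (rule \<Theta>(4))
  have "projectively_equivalent \<L> (hopf_fibers \<iota> \<alpha>)" if "quadratic_extension \<iota> \<alpha>"
  proof -
    interpret H: hopf_extension \<iota> \<alpha> using that by (rule hopf_extension.intro)
    \<comment> \<open>Both \<open>m\<close> and \<open>H.m\<close> are nonsquares of a finite field;
      rescaling \<Theta> by \<open>c\<close> keeps all lines invariant and makes its square equal to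
      \<open>H.m\<close>.\<close>
    obtain c where c: "c \<noteq> 0" "H.m = c * c * m"
      using nonsquare_quotient_square[OF \<Theta>(3) H.nonsquare] .
    have cs: "quadratic_structure (\<lambda>v. c *s \<Theta> v) H.m"
      using J.quadratic_structure_scale[OF c(1)] c(2) by simp
    have "invariant_spread \<L> (\<lambda>v. c *s \<Theta> v) H.m"
      by (intro invariant_spread.intro spread4_axioms cs invariant_spread_axioms.intro)
        (blast intro: \<Theta>(4) vec.subspace_scale line(1))
    from invariant_spread.projectively_equivalent_hopf[OF this H.hopf_extension_axioms refl]
    show ?thesis .
  qed
  moreover have "cyclic_group (groupoid_group \<L> L)"
    using groupoid_group_cyclic[OF assms(3) _ G.is_group] by simp
  moreover have "Coset.order (groupoid_group \<L> L) = CARD('k) + 1"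
    using order_groupoid_group[OF assms(3)] by simp
  ultimately show ?thesis by blast
qed

end
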